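(* Let $n\ge2$ and $\alpha\ge0$. If $n\sqrt n\,\alpha\le\dfrac1{6.1}$, then all mappings in $\mathcal F_\alpha^0$ are holomorphic in $\mathbb P^n$.
   Context: $\mathbb P^n=\{z\in\mathbb C^n:|z_i|<1,\ i=1,\dots,n\}$. For a locally biholomorphic $f=(f_1,\dots,f_n)$ with complex Jacobian determinant $J_f=\det Df$, the Schwarzian derivatives are $$S^k_{ij}f=\sum_{l=1}^n\frac{\partial^2 f_l}{\partial z_i\partial z_j}\frac{\partial z_k}{\partial f_l}-\frac1{n+1}\Big(\delta^k_i\frac{\partial}{\partial z_j}+\delta^k_j\frac{\partial}{\partial z_i}\Big)\log J_f,\qquad i,j,k=1,\dots,n,$$ where $\partial z_k/\partial f_l$ is the $(k,l)$ entry of $(Df)^{-1}$. The Schwarzian operator is $S_f(z)(\vec v)=(\vec v^{\,t}S^1_f(z)\vec v,\dots,\vec v^{\,t}S^n_f(z)\vec v)$, where $S^k_f=(S^k_{ij}f)_{i,j}$. The Bergman norm of $\vec v\in T_z\mathbb P^n$ is $\|\vec v\|=\big[2\sum_i|v_i|^2/(1-|z_i|^2)^2\big]^{1/2}$; $\|S_f(z)\|=\sup_{\|\vec v\|=1}\|S_f(z)(\vec v)\|$ and $\|S_f\|=\sup_{z\in\mathbb P^n}\|S_f(z)\|$. $\mathcal F_\alpha$ is the set of locally biholomorphic $f:\mathbb P^n\to\mathbb C^n$ with $f(0)=0$, $Df(0)=I$, $\|S_f\|\le\alpha$. $\mathcal F^0_\alpha$ is the set of mappings $g=T_a\circ f$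 with $f\in\mathcal F_\alpha$, $(n+1)a=\nabla J_f(0)$ and $T_a(w)=w/(1+a_1w_1+\dots+a_nw_n)$ (so that $g(0)=0$, $Dg(0)=I$, $\nabla J_g(0)=0$). A priori $g$ is only defined away from the singular set $\{1+a_1f_1+\dots+a_nf_n=0\}$; "$g$ is holomorphic in $\mathbb P^n$" means that this set is empty, i.e. $f(\mathbb P^n)$ misses the hyperplane $1+a_1w_1+\dots+a_nw_n=0$. *)

theory Defs
  imports "HOL-Analysis.Analysis"
begin

definition polydisc :: "(complex^'n) set" where
  "polydisc = {z. \<forall>i. norm (z $ i) < 1}"

text \<open>Multiplication by a complex matrix is exactly a complex-linear map, so this is Frechet
  differentiability over the complex numbers. It is meant for open \<open>U\<close>.\<close>

definition cn_holomorphic_on :: "(complex^'n \<Rightarrow> complex^'m) \<Rightarrow> (complex^'n) set \<Rightarrow> bool" where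
  "cn_holomorphic_on f U \<longleftrightarrow>
     (\<forall>z\<in>U. \<exists>A :: complex^'n^'m. (f has_derivative (\<lambda>h. A *v h)) (at z))"

definition biholomorphic_on :: "(complex^'n \<Rightarrow> complex^'n) \<Rightarrow> (complex^'n) set \<Rightarrow> bool" where
  "biholomorphic_on f V \<longleftrightarrow>
     open V \<and> open (f ` V) \<and> inj_on f V \<and>
     cn_holomorphic_on f V \<and> cn_holomorphic_on (inv_into V f) (f ` V)"

definition locally_biholomorphic_on :: "(complex^'n \<Rightarrow> complex^'n) \<Rightarrow> (complex^'n) set \<Rightarrow> bool" where
  "locally_biholomorphic_on f U \<longleftrightarrow> (\<forall>z\<in>U. \<exists>V. z \<in> V \<and> V \<subseteq> U \<and> biholomorphic_on f V)"

definition cpartial :: "'n \<Rightarrow> (complex^'n \<Rightarrow> complex) \<Rightarrow> complex^'n \<Rightarrow> complex" where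
  "cpartial i h z = deriv (\<lambda>t. h (z + axis i t)) 0"

definition cjacobian :: "(complex^'n \<Rightarrow> complex^'n) \<Rightarrow> complex^'n \<Rightarrow> complex^'n^'n" where
  "cjacobian f z = (\<chi> l i. cpartial i (\<lambda>w. f w $ l) z)"

definition cjacobian_det :: "(complex^'n \<Rightarrow> complex^'n) \<Rightarrow> complex^'n \<Rightarrow> complex" where
  "cjacobian_det f z = det (cjacobian f z)"

definition cgradient :: "(complex^'n \<Rightarrow> complex) \<Rightarrow> complex^'n \<Rightarrow> complex^'n" where
  "cgradient h z = (\<chi> i. cpartial i h z)"

text \<open>The derivative of any local branch of \<open>log h\<close>. The principal branch \<open>Ln\<close> would be wrong
  where \<open>h\<close> takes negative real values.\<close>

definition log_cpartial :: "'n \<Rightarrow> (complex^'n \<Rightarrow> complex) \<Rightarrow> complex^'n \<Rightarrow> complex" where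
  "log_cpartial i h z = cpartial i h z / h z"

definition schwarzian_deriv ::
  "(complex^'n \<Rightarrow> complex^'n) \<Rightarrow> 'n \<Rightarrow> 'n \<Rightarrow> 'n \<Rightarrow> complex^'n \<Rightarrow> complex" where
  "schwarzian_deriv f k i j z =
     (\<Sum>l\<in>UNIV. cpartial i (cpartial j (\<lambda>w. f w $ l)) z * matrix_inv (cjacobian f z) $ k $ l)
     - 1 / of_nat (CARD('n) + 1) *
       ((if k = i then log_cpartial j (cjacobian_det f) z else 0) +
        (if k = j then log_cpartial i (cjacobian_det f) z else 0))"

definition schwarzian_op ::
  "(complex^'n \<Rightarrow> complex^'n) \<Rightarrow> complex^'n \<Rightarrow> complex^'n \<Rightarrow> complex^'n" where
  "schwarzian_op f z v =
     (\<chi> k. \<Sum>i\<in>UNIV. \<Sum>j\<in>UNIV. v $ i * schwarzian_deriv f k i j z * v $ j)"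

definition bergman_norm :: "complex^'n \<Rightarrow> complex^'n \<Rightarrow> real" where
  "bergman_norm z v = sqrt (2 * (\<Sum>i\<in>UNIV. (norm (v $ i))\<^sup>2 / (1 - (norm (z $ i))\<^sup>2)\<^sup>2))"

text \<open>The suprema are taken in the extended reals because the norm of the Schwarzian operator
  over the polydisc may be infinite.\<close>

definition schwarzian_norm_at :: "(complex^'n \<Rightarrow> complex^'n) \<Rightarrow> complex^'n \<Rightarrow> ereal" where
  "schwarzian_norm_at f z =
     (SUP v\<in>{v. bergman_norm z v = 1}. ereal (bergman_norm z (schwarzian_op f z v)))"

definition schwarzian_norm :: "(complex^'n \<Rightarrow> complex^'n) \<Rightarrow> ereal" where
  "schwarzian_norm f = (SUP z\<in>polydisc. schwarzian_norm_at f z)"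

text \<open>Members are total functions, but only their values on \<^const>\<open>polydisc\<close> matter.\<close>

definition schwarz_family :: "real \<Rightarrow> (complex^'n \<Rightarrow> complex^'n) set" where
  "schwarz_family \<alpha> =
     {f. locally_biholomorphic_on f polydisc \<and> f 0 = 0 \<and> cjacobian f 0 = mat 1 \<and>
         schwarzian_norm f \<le> ereal \<alpha>}"

text \<open>Maps that may be singular at some points of the polydisc are partial maps, undefined at the
  singularities; in particular \<open>x / 0 = 0\<close> never supplies a value.\<close>

definition projective_map :: "complex^'n \<Rightarrow> complex^'n \<rightharpoonup> complex^'n" where
  "projective_map a w =
     (let d = 1 + (\<Sum>i\<in>UNIV. a $ i * w $ i) in if d = 0 then None else Some (inverse d *s w))"

definition schwarz_family0 :: "real \<Rightarrow> (complex^'n \<rightharpoonup> complex^'n) set" where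
  "schwarz_family0 \<alpha> =
     {(projective_map a \<circ> f) |` polydisc | a f.
        f \<in> schwarz_family \<alpha> \<and> of_nat (CARD('n) + 1) *s a = cgradient (cjacobian_det f) 0}"

text \<open>A partial map is holomorphic in \<open>U\<close> if it has no singularity in \<open>U\<close>, that is, it is
  defined on all of \<open>U\<close>, and is complex differentiable there. No extension across removable
  singularities is allowed.\<close>

definition holomorphic_in :: "(complex^'n \<rightharpoonup> complex^'n) \<Rightarrow> (complex^'n) set \<Rightarrow> bool" where
  "holomorphic_in g U \<longleftrightarrow> U \<subseteq> dom g \<and> cn_holomorphic_on (\<lambda>z. the (g z)) U"

end

(* The function u = J_f^(-1/(n+1)) (1 + a.f) solves the linear system d_i d_j u = sum_k S^k_ij d_k u + Q_ij u
   with u(0) = 1 and grad u(0) = 0, and u vanishes exactly where f meets the singular hyperplane of T_a. Its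
   logarithmic gradient w solves the Riccati system d_j w_i = sum_k S^k_ij w_k + Q_ij - w_i w_j. For n >= 2
   integrability expresses Q through the S^k_ij and their first derivatives, so Schwarz-Pick type estimates
   bound Q. On rays t zeta with all |zeta_i| = 1 these bounds make (t + e)/(1 - t^2) a strict supersolution of
   the scalar Riccati inequality for sqrt n |w|, so w stays bounded on every torus |z_i| = t < b as long as
   1 + a.f has no zero in the open polydisc of radius b. The maximum principle applied to 1/(1 + a.f) carries
   the resulting lower bound from tori to polydiscs, which excludes a zero of minimal sup norm. *)

theory Submission
  imports Defs "HOL-Complex_Analysis.Conformal_Mappings"
begin

section \<open>Holomorphic functions of several variables\<close>

text \<open>In coordinates scaled by \<open>rho z i\<close> the Schwarzian becomes a bilinear form
  \<open>T\<close> bounded by \<open>M\<close>, but going back costs quotients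
  \<open>rho z i / rho z k\<close>, which are unbounded over the polydisc. They equal 1 where all
  |z_i| agree. This is why the differential inequality is run only along rays through such points,
  and why a maximum principle has to recover the rest. The derivatives in Q stay affordable because
  S^k_ij vanishes for k different from i and j: in z_k alone it tends to 0 at the boundary of the
  disc. Hence the divergence of S has at most two terms for each pair i, j. With y = sqrt n w along
  a ray the inequality reads |y'| <= A |y| / (1 - t^2) + B / (1 - t^2)^2 + |y|^2, where A is
  \<open>M\<close> times sqrt n and B is n times \<open>R\<close>, and the supersolution works for
  small e as soon as A + B < 1. The constant 6.1 enters only there. The tight dimension is n = 2:
  with the plain bound \<open>M\<close> for the entries \<open>S i i j\<close> the estimate of A + B
  would exceed 1 at the largest admissible \<alpha>, hence the sharper constant
  \<open>m\<close>.\<close>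

lemma norm_axis_complex: "norm (axis i (x::complex)) = norm x"
  by (simp add: axis_def norm_vec_def L2_set_def if_distrib if_distribR cong: if_cong)

lemma axis_zero [simp]: "axis i (0::complex) = 0"
  by (simp add: axis_def vec_eq_iff)

lemma bounded_linear_axis: "bounded_linear (axis i :: complex \<Rightarrow> complex^'n)"
  by (rule bounded_linear_intro[where K=1])
     (auto simp: norm_axis_complex, auto simp: axis_def vec_eq_iff)

text \<open>Explicit coefficients force \<open>a i\<close> to be \<open>cpartial i h z\<close> (see
  \<open>cpartial_eq\<close>). Only pointwise complex differentiability is demanded; continuity and
  differentiability of the partials are derived from Cauchy's formula.\<close>

definition mhol :: "(complex^'n \<Rightarrow> complex) \<Rightarrow> (complex^'n) set \<Rightarrow> bool" where
  "mhol h U \<longleftrightarrow> (\<forall>z\<in>U. \<exists>a. (h has_derivative (\<lambda>v. \<Sum>i\<in>UNIV. a i * v $ i)) (at z))"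

lemma has_derivative_along_axis:
  fixes h :: "complex^'n \<Rightarrow> complex"
  assumes "(h has_derivative (\<lambda>v. \<Sum>i\<in>UNIV. a i * v $ i)) (at z)"
  shows "((\<lambda>t. h (z + axis i t)) has_field_derivative a i) (at 0)"
proof -
  have ax: "((\<lambda>t. z + axis i t) has_derivative (\<lambda>t. axis i t)) (at (0::complex))"
    by (auto intro!: derivative_eq_intros bounded_linear.has_derivative[OF bounded_linear_axis])
  have "((\<lambda>t. h (z + axis i t)) has_derivative (\<lambda>t. \<Sum>k\<in>UNIV. a k * axis i t $ k)) (at 0)"
    using diff_chain_at[OF ax, of h] assms by (simp add: o_def)
  moreover have "(\<lambda>t. \<Sum>k\<in>UNIV. a k * axis i t $ k) = (\<lambda>t. a i * t)"
    by (auto simp: axis_def if_distrib cong: if_cong)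
  ultimately show ?thesis by (simp add: has_field_derivative_def)
qed

lemma cpartial_eq:
  assumes "(h has_derivative (\<lambda>v. \<Sum>i\<in>UNIV. a i * v $ i)) (at z)"
  shows "cpartial i h z = a i"
  using has_derivative_along_axis[OF assms] by (simp add: cpartial_def DERIV_imp_deriv)

lemma mholD:
  assumes "mhol h U" "z \<in> U"
  shows "(h has_derivative (\<lambda>v. \<Sum>i\<in>UNIV. cpartial i h z * v $ i)) (at z)"
proof -
  obtain a where a: "(h has_derivative (\<lambda>v. \<Sum>i\<in>UNIV. a i * v $ i)) (at z)"
    using assms unfolding mhol_def by blast
  show ?thesis using a cpartial_eq[OF a] by simp
qed

lemma mholI:
  assumes "\<And>z. z \<in> U \<Longrightarrow> (h has_derivative (\<lambda>v. \<Sum>i\<in>UNIV. a z i * v $ i)) (at z)"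
  shows "mhol h U"
  unfolding mhol_def using assms by blast

lemma mhol_axis:
  assumes "mhol h U" "z \<in> U"
  shows "((\<lambda>t. h (z + axis i t)) has_field_derivative cpartial i h z) (at 0)"
  using has_derivative_along_axis[OF mholD[OF assms]] .

lemma mhol_continuous: "mhol h U \<Longrightarrow> continuous_on U h"
  by (meson has_derivative_continuous mholD continuous_at_imp_continuous_on)

lemma mhol_subset: "mhol h U \<Longrightarrow> V \<subseteq> U \<Longrightarrow> mhol h V"
  by (auto simp: mhol_def)

lemma mhol_const: "mhol (\<lambda>_. c) U"
  by (rule mholI[where a="\<lambda>_ _. 0"]) simp

lemma mhol_add: "mhol g U \<Longrightarrow> mhol h U \<Longrightarrow> mhol (\<lambda>z. g z + h z) U"
  by (rule mholI[where a="\<lambda>z i. cpartial i g z + cpartial i h z"])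
     (auto intro!: derivative_eq_intros mholD simp: algebra_simps sum.distrib)

lemma mhol_mult: "mhol g U \<Longrightarrow> mhol h U \<Longrightarrow> mhol (\<lambda>z. g z * h z) U"
  by (rule mholI[where a="\<lambda>z i. cpartial i g z * h z + g z * cpartial i h z"])
     (auto intro!: derivative_eq_intros mholD
       simp: algebra_simps sum.distrib sum_distrib_left sum_distrib_right)

lemma mhol_cmult: "mhol h U \<Longrightarrow> mhol (\<lambda>z. c * h z) U"
  by (intro mhol_mult mhol_const)

lemma mhol_minus: "mhol h U \<Longrightarrow> mhol (\<lambda>z. - h z) U"
  using mhol_cmult[of h U "-1"] by simp

lemma mhol_diff: "mhol g U \<Longrightarrow> mhol h U \<Longrightarrow> mhol (\<lambda>z. g z - h z) U"
  using mhol_add[of g U "\<lambda>z. - h z"] mhol_minus[of h U] by simp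

lemma mhol_sum: "(\<And>a. a \<in> A \<Longrightarrow> mhol (h a) U) \<Longrightarrow> mhol (\<lambda>z. \<Sum>a\<in>A. h a z) U"
  by (induction A rule: infinite_finite_induct) (auto intro: mhol_const mhol_add)

lemma mhol_prod: "(\<And>a. a \<in> A \<Longrightarrow> mhol (h a) U) \<Longrightarrow> mhol (\<lambda>z. \<Prod>a\<in>A. h a z) U"
  by (induction A rule: infinite_finite_induct) (auto intro: mhol_const mhol_mult)

lemma mhol_inverse:
  assumes "mhol h U" "\<And>z. z \<in> U \<Longrightarrow> h z \<noteq> 0"
  shows "mhol (\<lambda>z. inverse (h z)) U"
proof (rule mholI)
  fix z assume z: "z \<in> U"
  show "((\<lambda>z. inverse (h z)) has_derivative
      (\<lambda>v. \<Sum>i\<in>UNIV. (- (inverse (h z) * cpartial i h z * inverse (h z))) * v $ i)) (at z)"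
    using Deriv.has_derivative_inverse[OF assms(2)[OF z] mholD[OF assms(1) z]]
    by (simp add: sum_distrib_left sum_distrib_right sum_negf mult_ac)
qed

lemma mhol_divide:
  assumes "mhol g U" "mhol h U" "\<And>z. z \<in> U \<Longrightarrow> h z \<noteq> 0"
  shows "mhol (\<lambda>z. g z / h z) U"
  using mhol_mult[OF assms(1) mhol_inverse[OF assms(2,3)]] by (simp add: field_simps)

lemma mhol_cong:
  assumes "open U" "\<And>z. z \<in> U \<Longrightarrow> g z = h z" "mhol g U"
  shows "mhol h U"
  by (rule mholI[where a="\<lambda>z i. cpartial i g z"])
     (rule has_derivative_transform_within_open[OF mholD[OF assms(3)] assms(1)], use assms in auto)

lemma cpartial_cong_open:
  assumes "open U" "z \<in> U" "\<And>z. z \<in> U \<Longrightarrow> g z = h z" "mhol g U"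
  shows "cpartial i g z = cpartial i h z"
proof -
  have "(h has_derivative (\<lambda>v. \<Sum>i\<in>UNIV. cpartial i g z * v $ i)) (at z)"
    by (rule has_derivative_transform_within_open[OF mholD[OF assms(4)] assms(1)])
       (use assms in auto)
  then show ?thesis by (simp add: cpartial_eq)
qed

lemma cpartial_const [simp]: "cpartial i (\<lambda>_. c) z = 0"
  by (simp add: cpartial_def)

lemma cpartial_add:
  assumes "mhol g U" "mhol h U" "z \<in> U"
  shows "cpartial i (\<lambda>z. g z + h z) z = cpartial i g z + cpartial i h z"
  using DERIV_add[OF mhol_axis[OF assms(1,3)] mhol_axis[OF assms(2,3)], of i]
  unfolding cpartial_def[of _ "\<lambda>z. g z + h z"] by (rule DERIV_imp_deriv)

lemma cpartial_mult:
  assumes "mhol g U" "mhol h U" "z \<in> U"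
  shows "cpartial i (\<lambda>z. g z * h z) z = cpartial i g z * h z + g z * cpartial i h z"
  using DERIV_mult[OF mhol_axis[OF assms(1,3), of i] mhol_axis[OF assms(2,3), of i]]
  unfolding cpartial_def[of _ "\<lambda>z. g z * h z"]
  by (simp add: DERIV_imp_deriv algebra_simps)

lemma cpartial_cmult:
  assumes "mhol h U" "z \<in> U"
  shows "cpartial i (\<lambda>z. c * h z) z = c * cpartial i h z"
  using cpartial_mult[OF mhol_const assms] by simp

lemma cpartial_minus:
  assumes "mhol h U" "z \<in> U"
  shows "cpartial i (\<lambda>z. - h z) z = - cpartial i h z"
  using cpartial_cmult[OF assms, of i "-1"] by simp

lemma cpartial_diff:
  assumes "mhol g U" "mhol h U" "z \<in> U"
  shows "cpartial i (\<lambda>z. g z - h z) z = cpartial i g z - cpartial i h z"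
  using cpartial_add[OF assms(1) mhol_minus[OF assms(2)] assms(3)] cpartial_minus[OF assms(2,3)]
  by simp

lemma cpartial_sum:
  assumes "\<And>a. a \<in> A \<Longrightarrow> mhol (h a) U" "z \<in> U"
  shows "cpartial i (\<lambda>z. \<Sum>a\<in>A. h a z) z = (\<Sum>a\<in>A. cpartial i (h a) z)"
  using assms
proof (induction A rule: infinite_finite_induct)
  case (insert a A)
  then have "cpartial i (\<lambda>z. h a z + (\<Sum>a\<in>A. h a z)) z = cpartial i (h a) z + (\<Sum>a\<in>A. cpartial i (h a) z)"
    by (subst cpartial_add[where U=U]) (auto intro: mhol_sum)
  with insert show ?case by simp
qed auto

lemma cpartial_inverse:
  assumes "mhol h U" "z \<in> U" "h z \<noteq> 0"
  shows "cpartial i (\<lambda>z. inverse (h z)) z = - (inverse (h z) * cpartial i h z * inverse (h z))"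
proof -
  have 0: "z + axis i 0 = z" by (simp add: axis_def vec_eq_iff)
  show ?thesis
    using DERIV_inverse'[OF mhol_axis[OF assms(1,2), of i]] assms(3) 0
    unfolding cpartial_def[of _ "\<lambda>z. inverse (h z)"] by (subst DERIV_imp_deriv) auto
qed

lemma axis_add: "axis i (a + b) = axis i a + axis i (b::complex)"
  by (simp add: axis_def vec_eq_iff)

lemma mhol_axis_at:
  assumes "mhol h U" "z + axis i s \<in> U"
  shows "((\<lambda>t. h (z + axis i t)) has_field_derivative cpartial i h (z + axis i s)) (at s)"
proof -
  have *: "((\<lambda>t. h (z + axis i s + axis i t)) has_field_derivative cpartial i h (z + axis i s)) (at (s - s))"
    using mhol_axis[OF assms] by simp
  have "((\<lambda>t. h (z + axis i s + axis i (t - s))) has_field_derivative cpartial i h (z + axis i s) * 1) (at s)"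
    by (rule DERIV_chain2[where g="\<lambda>t. t - s", OF *]) (auto intro!: derivative_eq_intros)
  moreover have "z + axis i s + axis i (t - s) = z + axis i t" for t
    using axis_add[of i s "t - s"] by (simp add: add.assoc)
  ultimately show ?thesis by simp
qed

section \<open>Cauchy's formula on coordinate circles and second derivatives\<close>

definition circ :: "real \<Rightarrow> complex" where "circ x = exp (2 * of_real pi * \<i> * of_real x)"

lemma norm_circ [simp]: "norm (circ x) = 1"
  by (simp add: circ_def)

lemma continuous_on_circ [continuous_intros]: "continuous_on A f \<Longrightarrow> continuous_on A (\<lambda>x. circ (f x))"
  unfolding circ_def by (intro continuous_intros)

lemma circlepath_eq: "circlepath 0 r x = r * circ x"
  by (simp add: circlepath circ_def)

text \<open>The contour integral is rewritten over the fixed interval \<open>{0..1}\<close>, so that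
  theorems on integrals with a parameter apply. The factor dz = 2 pi i r \<open>circ x\<close> dx
  cancels one of the two powers in the Cauchy kernel.\<close>

lemma Cauchy_deriv_integral:
  assumes "continuous_on (cball 0 r) f" "f holomorphic_on ball 0 r" "r > 0"
  shows "((\<lambda>x. f (r * circ x) * (inverse (circ x) / r)) has_integral deriv f 0) {0..1}"
proof -
  have "((\<lambda>u. f u / u ^ Suc 1) has_contour_integral (2 * pi * \<i> * deriv f 0)) (circlepath 0 r)"
    using Cauchy_has_contour_integral_higher_derivative_circlepath[OF assms(1,2), of 0 1] assms(3)
    by simp
  then have "((\<lambda>x. f (circlepath 0 r x) / circlepath 0 r x ^ 2 *
       vector_derivative (circlepath 0 r) (at x within {0..1})) has_integral (2 * pi * \<i> * deriv f 0)) {0..1}"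
    by (simp add: has_contour_integral_def power2_eq_square)
  then have "((\<lambda>x. f (r * circ x) / (r * circ x) ^ 2 * (2 * pi * \<i> * r * circ x))
      has_integral (2 * pi * \<i> * deriv f 0)) {0..1}"
    by (rule has_integral_eq[rotated])
       (simp add: circlepath_eq vector_derivative_circlepath01 circ_def mult_ac)
  then have "((\<lambda>x. inverse (2 * pi * \<i>) * (f (r * circ x) / (r * circ x) ^ 2 * (2 * pi * \<i> * r * circ x)))
      has_integral inverse (2 * pi * \<i>) * (2 * pi * \<i> * deriv f 0)) {0..1}"
    by (rule has_integral_mult_right)
  moreover have "inverse (2 * pi * \<i>) * (f (r * circ x) / (r * circ x) ^ 2 * (2 * pi * \<i> * r * circ x))
      = f (r * circ x) * (inverse (circ x) / r)" for x
    using assms(3) by (simp add: circ_def field_simps power2_eq_square)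
  moreover have "inverse (2 * pi * \<i>) * (2 * pi * \<i> * deriv f 0) = deriv f 0"
    by (simp add: field_simps)
  ultimately show ?thesis by (simp only:)
qed

lemma cpartial_integral:
  assumes h: "mhol h U" and r: "r > 0" and sub: "\<And>s. norm s \<le> r \<Longrightarrow> z + axis i s \<in> U"
  shows "cpartial i h z = integral {0..1} (\<lambda>x. h (z + axis i (r * circ x)) * (inverse (circ x) / r))"
proof -
  let ?f = "\<lambda>t. h (z + axis i t)"
  have d: "(?f has_field_derivative cpartial i h (z + axis i s)) (at s)" if "norm s \<le> r" for s
    using mhol_axis_at[OF h sub[OF that]] .
  have "continuous_on (cball 0 r) ?f"
    by (rule DERIV_continuous_on[where D="\<lambda>s. cpartial i h (z + axis i s)"])
       (rule has_field_derivative_at_within[OF d], simp)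
  moreover have "?f holomorphic_on ball 0 r"
    unfolding holomorphic_on_def field_differentiable_def
    by (rule ballI, rule exI, rule has_field_derivative_at_within[OF d], simp)
  ultimately show ?thesis
    unfolding cpartial_def using r by (intro integral_unique[symmetric] Cauchy_deriv_integral)
qed

lemma axis_shift_mem:
  fixes z0 :: "complex^'n"
  assumes "ball z0 (3 * d) \<subseteq> U" "z \<in> ball z0 d" "norm s \<le> d"
  shows "z + axis i s \<in> U"
proof -
  have "dist z0 (z + axis i s) \<le> dist z0 z + norm (axis i s)"
    by norm
  also have "\<dots> < 3 * d"
    using assms(2,3) norm_axis_complex[of i s] zero_le_dist[of z0 z] unfolding mem_ball by linarith
  finally show ?thesis using assms(1) by auto
qed

lemma continuous_on_axis [continuous_intros]:
  assumes "continuous_on A f"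
  shows "continuous_on A (\<lambda>x. axis i (f x :: complex))"
  by (rule bounded_linear.continuous_on[OF bounded_linear_axis assms])

lemma axis_shift_continuous:
  fixes h :: "complex^'n \<Rightarrow> complex"
  assumes c: "continuous_on U h" and sub: "\<And>z s. z \<in> V \<Longrightarrow> norm s \<le> d \<Longrightarrow> z + axis i s \<in> U"
    and d: "d > 0"
  shows "continuous_on (V \<times> cbox 0 1) (\<lambda>(z, x). h (z + axis i (d * circ x)) * (inverse (circ x) / d))"
proof -
  have nz: "circ x \<noteq> 0" for x using norm_circ[of x] by (metis norm_zero zero_neq_one)
  show ?thesis
    unfolding split_beta
    by (intro continuous_intros continuous_on_compose2[OF c])
       (use sub d nz in \<open>auto simp: norm_mult\<close>)
qed

text \<open>The Cauchy integral of the continuous \<open>h\<close> depends continuously on its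
  centre. The Leibniz rule used next needs this continuity.\<close>

lemma cpartial_continuous:
  fixes h :: "complex^'n \<Rightarrow> complex"
  assumes "open U" "mhol h U"
  shows "continuous_on U (cpartial i h)"
proof (rule continuous_at_imp_continuous_on, rule ballI)
  fix z0 assume "z0 \<in> U"
  then obtain e where e: "e > 0" "ball z0 e \<subseteq> U" using assms(1) openE by blast
  define d where "d = e / 3"
  have d: "d > 0" "ball z0 (3 * d) \<subseteq> U" using e by (auto simp: d_def)
  note sub = axis_shift_mem[OF d(2)]
  have "continuous_on (ball z0 d) (\<lambda>z. integral (cbox 0 1) (\<lambda>x. h (z + axis i (d * circ x)) * (inverse (circ x) / d)))"
    by (rule integral_continuous_on_param)
       (rule axis_shift_continuous[OF mhol_continuous[OF assms(2)] sub d(1)])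
  moreover have "integral (cbox 0 1) (\<lambda>x. h (z + axis i (d * circ x)) * (inverse (circ x) / d)) = cpartial i h z"
    if "z \<in> ball z0 d" for z
    using cpartial_integral[OF assms(2) d(1), of z i] sub[OF that] by simp
  ultimately have "continuous_on (ball z0 d) (cpartial i h)"
    by (rule continuous_on_eq)
  then show "isCont (cpartial i h) z0"
    using d(1) by (metis centre_in_ball continuous_on_interior interior_ball)
qed

text \<open>Differentiation under the integral sign in Cauchy's formula.\<close>

lemma cpartial_has_derivative:
  fixes h :: "complex^'n \<Rightarrow> complex"
  assumes "open U" "mhol h U" "z0 \<in> U"
  shows "\<exists>d>0. (\<forall>s. norm s \<le> d \<longrightarrow> z0 + axis i s \<in> U) \<and>
    (cpartial i h has_derivative (\<lambda>v. \<Sum>j\<in>UNIV. integral {0..1}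
       (\<lambda>x. cpartial j h (z0 + axis i (of_real d * circ x)) * (inverse (circ x) / of_real d)) * v $ j)) (at z0)"
proof -
  obtain e where e: "e > 0" "ball z0 e \<subseteq> U" using assms(1,3) openE by blast
  define d where "d = e / 3"
  have d: "d > 0" "ball z0 (3 * d) \<subseteq> U" using e by (auto simp: d_def)
  note sub = axis_shift_mem[OF d(2)]
  have z0: "z0 \<in> ball z0 d" using d by simp
  have "(cpartial i h has_derivative (\<lambda>v. \<Sum>j\<in>UNIV.
       integral {0..1} (\<lambda>x. cpartial j h (z0 + axis i (d * circ x)) * (inverse (circ x) / d)) * v $ j)) (at z0)"
  proof -
    define c where "c = (\<lambda>j z x. cpartial j h (z + axis i (d * circ x)) * (inverse (circ x) / d))"
    define pr :: "'n \<Rightarrow> (complex^'n) \<Rightarrow>\<^sub>L complex" where "pr = (\<lambda>j. Blinfun (\<lambda>v. v $ j))"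
    have pr: "blinfun_apply (pr j) v = v $ j" for j v
      unfolding pr_def by (subst bounded_linear_Blinfun_apply) (auto intro: bounded_linear_vec_nth)
    \<comment> \<open>The Leibniz rule asks for the derivative as a continuous family of bounded
      linear maps, so the total derivative of the integrand is packed into one.\<close>
    define G where "G = (\<lambda>z x. \<Sum>j\<in>UNIV. blinfun_mult_right (c j z x) o\<^sub>L pr j)"
    have G: "blinfun_apply (G z x) v = (\<Sum>j\<in>UNIV. c j z x * v $ j)" for z x v
      by (simp add: G_def pr blinfun.sum_left)
    have cc: "continuous_on (ball z0 d \<times> cbox 0 1) (\<lambda>(z, x). c j z x)" for j
      unfolding c_def
      by (rule axis_shift_continuous[OF cpartial_continuous[OF assms(1,2)] sub d(1)])
    have cG: "continuous_on (ball z0 d \<times> cbox 0 1) (\<lambda>(z, x). G z x)"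
      unfolding G_def split_beta
      using cc by (intro continuous_intros) (auto simp: split_beta)
    have ci: "continuous_on (cbox 0 1) (\<lambda>x. h (z + axis i (d * circ x)) * (inverse (circ x) / d))"
      if "z \<in> ball z0 d" for z
    proof -
      have "continuous_on (ball z0 d \<times> cbox 0 1) (\<lambda>(z, x). h (z + axis i (d * circ x)) * (inverse (circ x) / d))"
        by (rule axis_shift_continuous[OF mhol_continuous[OF assms(2)] sub d(1)])
      moreover have "continuous_on (cbox (0::real) 1) (Pair z)" "Pair z ` cbox 0 1 \<subseteq> ball z0 d \<times> cbox (0::real) 1"
        using that by (auto intro!: continuous_intros)
      ultimately have "continuous_on (cbox 0 1) (\<lambda>x. case (z, x) of (z, x) \<Rightarrow>
          h (z + axis i (d * circ x)) * (inverse (circ x) / d))"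
        by (rule continuous_on_compose2)
      then show ?thesis by simp
    qed
    have intg: "(\<lambda>x. h (z + axis i (d * circ x)) * (inverse (circ x) / d)) integrable_on cbox 0 1"
      if "z \<in> ball z0 d" for z
      by (rule integrable_continuous) (rule ci[OF that])
    have der: "((\<lambda>z. h (z + axis i (d * circ x)) * (inverse (circ x) / d)) has_derivative
          blinfun_apply (G z x)) (at z within ball z0 d)"
      if z: "z \<in> ball z0 d" for z x
    proof -
      have m: "z + axis i (d * circ x) \<in> U" using sub[OF z] d by (simp add: norm_mult)
      have "((\<lambda>z. h (z + axis i (d * circ x))) has_derivative
         (\<lambda>v. \<Sum>j\<in>UNIV. cpartial j h (z + axis i (d * circ x)) * v $ j)) (at z)"
        by (rule has_derivative_compose[where f="\<lambda>z. z + axis i (d * circ x)" and f'="\<lambda>v. v",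
              OF _ mholD[OF assms(2) m]])
           (auto intro!: derivative_eq_intros)
      from has_derivative_mult_left[OF this, of "inverse (circ x) / d"]
      have "((\<lambda>z. h (z + axis i (d * circ x)) * (inverse (circ x) / d)) has_derivative
          blinfun_apply (G z x)) (at z)"
        unfolding G c_def by (simp add: sum_distrib_left sum_divide_distrib mult_ac)
      then show ?thesis by (rule has_derivative_at_withinI)
    qed
    have "((\<lambda>z. integral (cbox 0 1) (\<lambda>x. h (z + axis i (d * circ x)) * (inverse (circ x) / d)))
        has_derivative blinfun_apply (integral (cbox 0 1) (G z0))) (at z0 within ball z0 d)"
      by (rule leibniz_rule[OF der intg cG z0 convex_ball])
    then have D: "((\<lambda>z. integral {0..1} (\<lambda>x. h (z + axis i (d * circ x)) * (inverse (circ x) / d)))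
        has_derivative blinfun_apply (integral {0..1} (G z0))) (at z0)"
      unfolding at_within_open[OF z0 open_ball] cbox_interval .
    have D2: "(cpartial i h has_derivative blinfun_apply (integral {0..1} (G z0))) (at z0)"
      by (rule has_derivative_transform_within_open[OF D open_ball z0])
         (use cpartial_integral[OF assms(2) d(1)] sub in auto)
    have pz: "continuous_on {0..1::real} (Pair z0)" "Pair z0 ` {0..1::real} \<subseteq> ball z0 d \<times> cbox 0 1"
      using continuous_on_Pair[OF continuous_on_const continuous_on_id, of "{0..1::real}" z0] z0 by auto
    have cz: "continuous_on {0..1} (c j z0)" for j
      using continuous_on_compose2[OF cc[of j] pz] by simp
    have "continuous_on {0..1} (G z0)"
      using continuous_on_compose2[OF cG pz] by simp
    then have Gi: "G z0 integrable_on {0..1}"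
      by (rule integrable_continuous_real)
    have "blinfun_apply (integral {0..1} (G z0)) v = (\<Sum>j\<in>UNIV. integral {0..1} (c j z0) * v $ j)" for v
    proof -
      have "blinfun_apply (integral {0..1} (G z0)) v = integral {0..1} (\<lambda>x. blinfun_apply (G z0 x) v)"
        using blinfun_apply_integral[OF Gi] by simp
      also have "\<dots> = (\<Sum>j\<in>UNIV. integral {0..1} (\<lambda>x. c j z0 x * v $ j))"
        unfolding G by (rule integral_sum) (auto intro!: integrable_continuous_real continuous_intros cz)
      finally show ?thesis by simp
    qed
    then have "blinfun_apply (integral {0..1} (G z0)) = (\<lambda>v. \<Sum>j\<in>UNIV. integral {0..1} (c j z0) * v $ j)"
      by auto
    with D2 show ?thesis by (simp add: c_def)
  qed
  then show ?thesis using d(1) sub[OF z0] by (intro exI[of _ d]) simp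
qed

lemma mhol_cpartial:
  assumes "open U" "mhol h U"
  shows "mhol (cpartial i h) U"
  unfolding mhol_def
proof
  fix z assume "z \<in> U"
  from cpartial_has_derivative[OF assms this, of i] obtain d where
    "(cpartial i h has_derivative (\<lambda>v. \<Sum>j\<in>UNIV. integral {0..1}
       (\<lambda>x. cpartial j h (z + axis i (of_real d * circ x)) * (inverse (circ x) / of_real d)) * v $ j)) (at z)"
    by blast
  then show "\<exists>a. (cpartial i h has_derivative (\<lambda>v. \<Sum>j\<in>UNIV. a j * v $ j)) (at z)"
    by (rule exI[where x="\<lambda>j. integral {0..1}
       (\<lambda>x. cpartial j h (z + axis i (of_real d * circ x)) * (inverse (circ x) / of_real d))"])
qed

text \<open>The j-th coefficient of the derivative of \<open>cpartial i h\<close> is a Cauchy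
  integral of \<open>cpartial j h\<close> over a circle in direction i, and this integral also
  equals the i-th partial of \<open>cpartial j h\<close>.\<close>

lemma cpartial_commute:
  assumes "open U" "mhol h U" "z \<in> U"
  shows "cpartial j (cpartial i h) z = cpartial i (cpartial j h) z"
proof -
  obtain d where d: "d > 0" "\<And>s. norm s \<le> d \<Longrightarrow> z + axis i s \<in> U"
    "(cpartial i h has_derivative (\<lambda>v. \<Sum>j\<in>UNIV. integral {0..1}
       (\<lambda>x. cpartial j h (z + axis i (of_real d * circ x)) * (inverse (circ x) / of_real d)) * v $ j)) (at z)"
    using cpartial_has_derivative[OF assms, of i] by blast
  have "cpartial j (cpartial i h) z = integral {0..1}
       (\<lambda>x. cpartial j h (z + axis i (of_real d * circ x)) * (inverse (circ x) / of_real d))"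
    by (rule cpartial_eq[OF d(3)])
  also have "\<dots> = cpartial i (cpartial j h) z"
    by (rule cpartial_integral[OF mhol_cpartial[OF assms(1,2)] d(1,2), symmetric])
  finally show ?thesis .
qed

section \<open>Disc estimates and the maximum modulus principle\<close>

text \<open>Composition with the disc automorphism \<zeta> -> (\<zeta> + a) / (1 + cnj a \<zeta>)
  moves a derivative estimate from \<open>a\<close> to 0. The automorphism stays hidden; the
  identity for 1 - |w|^2 is exported because the weighted estimate below has to transport its
  weight.\<close>

lemma moebius_transfer:
  fixes a :: complex
  assumes F: "F holomorphic_on ball 0 1" and a: "norm a < 1"
  obtains H where "H holomorphic_on ball 0 1" "deriv H 0 = deriv F a * of_real (1 - (norm a)\<^sup>2)"
    "\<And>\<zeta>. norm \<zeta> < 1 \<Longrightarrow> \<exists>w. norm w < 1 \<and> H \<zeta> = F w \<and>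
       (1 - (norm w)\<^sup>2) * (norm (1 + cnj a * \<zeta>))\<^sup>2 = (1 - (norm a)\<^sup>2) * (1 - (norm \<zeta>)\<^sup>2)"
proof -
  define \<phi> where "\<phi> = (\<lambda>\<zeta>. (\<zeta> + a) / (1 + cnj a * \<zeta>))"
  have nz: "1 + cnj a * \<zeta> \<noteq> 0" if "norm \<zeta> < 1" for \<zeta>
  proof
    assume "1 + cnj a * \<zeta> = 0"
    then have "cnj a * \<zeta> = -1" by (simp add: add_eq_0_iff)
    then have "norm a * norm \<zeta> = 1" by (metis complex_mod_cnj norm_minus_cancel norm_mult norm_one)
    moreover have "norm a * norm \<zeta> < 1 * 1"
      by (rule mult_strict_mono) (use a that in auto)
    ultimately show False by simp
  qed
  have id: "(norm (1 + cnj a * \<zeta>))\<^sup>2 - (norm (\<zeta> + a))\<^sup>2 = (1 - (norm a)\<^sup>2) * (1 - (norm \<zeta>)\<^sup>2)" for \<zeta>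
    unfolding cmod_power2 by (simp add: algebra_simps power2_eq_square)
  have \<phi>1: "(1 - (norm (\<phi> \<zeta>))\<^sup>2) * (norm (1 + cnj a * \<zeta>))\<^sup>2 = (1 - (norm a)\<^sup>2) * (1 - (norm \<zeta>)\<^sup>2)"
    if "norm \<zeta> < 1" for \<zeta>
    using nz[OF that] id[of \<zeta>] by (simp add: \<phi>_def norm_divide power_divide left_diff_distrib)
  have \<phi>2: "norm (\<phi> \<zeta>) < 1" if "norm \<zeta> < 1" for \<zeta>
  proof -
    have "0 < (1 - (norm a)\<^sup>2) * (1 - (norm \<zeta>)\<^sup>2)"
      using a that by (simp add: power_less_one_iff)
    then have "0 < 1 - (norm (\<phi> \<zeta>))\<^sup>2"
      using \<phi>1[OF that] by (metis zero_less_mult_pos2 nz[OF that] zero_less_norm_iff zero_less_power)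
    then show ?thesis by (simp add: power_less_one_iff)
  qed
  have \<phi>h: "\<phi> holomorphic_on ball 0 1"
    unfolding \<phi>_def by (intro holomorphic_intros) (use nz in auto)
  have aa: "a * cnj a = (of_real (norm a))\<^sup>2"
    by (metis complex_norm_square of_real_power)
  have "(\<phi> has_field_derivative of_real (1 - (norm a)\<^sup>2)) (at 0)"
    unfolding \<phi>_def
    by (auto intro!: derivative_eq_intros simp: aa)
  moreover have "(F has_field_derivative deriv F a) (at (\<phi> 0))"
    using holomorphic_derivI[OF F open_ball, of a] a by (simp add: \<phi>_def)
  ultimately have "((\<lambda>\<zeta>. F (\<phi> \<zeta>)) has_field_derivative deriv F a * of_real (1 - (norm a)\<^sup>2)) (at 0)"
    by (rule DERIV_chain2[rotated])
  then have "deriv (\<lambda>\<zeta>. F (\<phi> \<zeta>)) 0 = deriv F a * of_real (1 - (norm a)\<^sup>2)"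
    by (rule DERIV_imp_deriv)
  moreover have "(\<lambda>\<zeta>. F (\<phi> \<zeta>)) holomorphic_on ball 0 1"
    by (rule holomorphic_on_compose_gen[OF \<phi>h F, unfolded o_def]) (use \<phi>2 in auto)
  ultimately show ?thesis using that[of "\<lambda>\<zeta>. F (\<phi> \<zeta>)"] \<phi>1 \<phi>2 by blast
qed

text \<open>Cauchy's inequality at 0 for the transported function on radius r < 1; letting r tend to
  1 loses nothing.\<close>

lemma Schwarz_Pick_deriv:
  assumes F: "F holomorphic_on ball 0 1" and a: "norm a < 1"
    and K: "\<And>z. norm z < 1 \<Longrightarrow> norm (F z) \<le> K"
  shows "norm (deriv F a) * (1 - (norm a)\<^sup>2) \<le> K"
proof -
  obtain H where H: "H holomorphic_on ball 0 1" "deriv H 0 = deriv F a * of_real (1 - (norm a)\<^sup>2)"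
    "\<And>\<zeta>. norm \<zeta> < 1 \<Longrightarrow> \<exists>w. norm w < 1 \<and> H \<zeta> = F w"
    by (rule moebius_transfer[OF F a]) blast
  have n: "norm (deriv H 0) = norm (deriv F a) * (1 - (norm a)\<^sup>2)"
  proof -
    have "\<bar>1 - (norm a)\<^sup>2\<bar> = 1 - (norm a)\<^sup>2"
      using a by (simp add: power_le_one)
    then show ?thesis unfolding H(2) norm_mult norm_of_real by simp
  qed
  show ?thesis
  proof (rule field_le_mult_one_interval)
    fix r :: real assume r: "0 < r" "r < 1"
    have hb: "H holomorphic_on ball 0 r" "continuous_on (cball 0 r) H"
      using r by (auto intro!: holomorphic_on_imp_continuous_on holomorphic_on_subset[OF H(1)])
    have "norm ((deriv ^^ 1) H 0) \<le> fact 1 * K / r ^ 1"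
      by (rule Cauchy_inequality[OF hb r(1)]) (use H(3) K r in fastforce)
    then show "r * (norm (deriv F a) * (1 - (norm a)\<^sup>2)) \<le> K"
      using r n by (simp add: field_simps)
  qed
qed

text \<open>Only the odd part of the transported function contributes to the derivative, and the
  parallelogram law removes the distortion factor \<open>\<bar>1 + cnj a * \<zeta>\<bar>\<^sup>2\<close>. Radius 1/2 is nearly optimal.\<close>

lemma deriv_bound_hyperbolic_weight:
  assumes F: "F holomorphic_on ball 0 1" and a: "norm a < 1"
    and K: "\<And>z. norm z < 1 \<Longrightarrow> norm (F z) * (1 - (norm z)\<^sup>2) \<le> K"
  shows "norm (deriv F a) * (1 - (norm a)\<^sup>2)\<^sup>2 \<le> 10 / 3 * K"
proof -
  let ?d = "1 - (norm a)\<^sup>2"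
  have d: "0 < ?d" using a by (simp add: power_less_one_iff)
  have K0: "0 \<le> K" using K[of 0] norm_ge_zero[of "F 0"] by (simp del: norm_ge_zero)
  obtain H where H: "H holomorphic_on ball 0 1" "deriv H 0 = deriv F a * of_real ?d"
    "\<And>\<zeta>. norm \<zeta> < 1 \<Longrightarrow> \<exists>w. norm w < 1 \<and> H \<zeta> = F w \<and>
       (1 - (norm w)\<^sup>2) * (norm (1 + cnj a * \<zeta>))\<^sup>2 = ?d * (1 - (norm \<zeta>)\<^sup>2)"
    by (rule moebius_transfer[OF F a]) blast
  have Hb: "norm (H \<zeta>) * (?d * (3/4)) \<le> K * (norm (1 + cnj a * \<zeta>))\<^sup>2" if "norm \<zeta> = 1/2" for \<zeta>
  proof -
    from H(3)[of \<zeta>] that obtain w where w: "norm w < 1" "H \<zeta> = F w"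
      "(1 - (norm w)\<^sup>2) * (norm (1 + cnj a * \<zeta>))\<^sup>2 = ?d * (1 - (norm \<zeta>)\<^sup>2)" by auto
    have "norm (F w) * ((1 - (norm w)\<^sup>2) * (norm (1 + cnj a * \<zeta>))\<^sup>2) \<le> K * (norm (1 + cnj a * \<zeta>))\<^sup>2"
      using mult_right_mono[OF K[OF w(1)], of "(norm (1 + cnj a * \<zeta>))\<^sup>2"] by (simp add: mult_ac)
    then show ?thesis unfolding w(2,3) that by (simp add: power2_eq_square)
  qed
  define G where "G = (\<lambda>\<zeta>. (H \<zeta> - H (- \<zeta>)) / 2)"
  have Gh: "G holomorphic_on ball 0 1"
    unfolding G_def
    by (intro holomorphic_intros H(1) holomorphic_on_compose_gen[OF _ H(1), unfolded o_def, of uminus]) auto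
  have "(H has_field_derivative deriv H 0) (at 0)"
    using holomorphic_derivI[OF H(1) open_ball, of 0] by simp
  moreover from this have "((\<lambda>\<zeta>. H (- \<zeta>)) has_field_derivative deriv H 0 * (-1)) (at 0)"
    by (intro DERIV_chain2[where g=uminus]) (auto intro!: derivative_eq_intros)
  ultimately have "(G has_field_derivative (deriv H 0 - deriv H 0 * (-1)) / 2) (at 0)"
    unfolding G_def by (intro DERIV_cdivide DERIV_diff)
  then have dG: "deriv G 0 = deriv H 0" by (simp add: DERIV_imp_deriv)
  have Gb: "norm (G \<zeta>) \<le> 5/3 * K / ?d" if z: "norm (0 - \<zeta>) = 1/2" for \<zeta>
  proof -
    have n1: "norm \<zeta> = 1/2" "norm (-\<zeta>) = 1/2" using z by auto
    let ?w = "cnj a * \<zeta>"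
    have "(norm ?w)\<^sup>2 \<le> (1/2)\<^sup>2"
      using a n1 by (intro power_mono) (auto simp: norm_mult n1)
    moreover have "(norm (1 + ?w))\<^sup>2 + (norm (1 - ?w))\<^sup>2 = 2 + 2 * (norm ?w)\<^sup>2"
      unfolding cmod_power2 by (simp add: power2_eq_square algebra_simps)
    ultimately have s: "(norm (1 + ?w))\<^sup>2 + (norm (1 - ?w))\<^sup>2 \<le> 5/2"
      by (simp add: power2_eq_square)
    have "norm (G \<zeta>) \<le> (norm (H \<zeta>) + norm (H (-\<zeta>))) / 2"
      unfolding G_def using norm_triangle_ineq4[of "H \<zeta>" "H (-\<zeta>)"] by (simp add: norm_divide)
    then have "norm (G \<zeta>) * (?d * (3/4)) \<le> (norm (H \<zeta>) + norm (H (-\<zeta>))) / 2 * (?d * (3/4))"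
      using d by (intro mult_right_mono) auto
    also have "\<dots> \<le> K * ((norm (1 + ?w))\<^sup>2 + (norm (1 - ?w))\<^sup>2) / 2"
    proof -
      have "(norm (H \<zeta>) + norm (H (-\<zeta>))) / 2 * (?d * (3/4))
          = (norm (H \<zeta>) * (?d * (3/4)) + norm (H (-\<zeta>)) * (?d * (3/4))) / 2"
        by (simp only: distrib_right times_divide_eq_left add_divide_distrib)
      also have "\<dots> \<le> (K * (norm (1 + ?w))\<^sup>2 + K * (norm (1 - ?w))\<^sup>2) / 2"
        using Hb[OF n1(1)] Hb[OF n1(2)] by (intro divide_right_mono add_mono) simp_all
      finally show ?thesis by (simp only: distrib_left)
    qed
    also have "\<dots> \<le> K * (5/2) / 2"
      using mult_left_mono[OF s K0] by simp
    finally show ?thesis using d by (simp add: field_simps)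
  qed
  have hb: "G holomorphic_on ball 0 (1/2)" "continuous_on (cball 0 (1/2)) G"
    by (auto intro!: holomorphic_on_imp_continuous_on holomorphic_on_subset[OF Gh])
  have "norm ((deriv ^^ 1) G 0) \<le> fact 1 * (5/3 * K / ?d) / (1/2) ^ 1"
    by (rule Cauchy_inequality[OF hb _ Gb]) auto
  moreover have "norm (deriv G 0) = norm (deriv F a) * ?d"
    using d unfolding dG H(2) norm_mult norm_of_real by simp
  ultimately have "norm (deriv F a) * ?d \<le> 10/3 * K / ?d" by simp
  then show ?thesis using d by (simp add: field_simps power2_eq_square)
qed

text \<open>On the circle of radius r the hypothesis bounds F by K (1 - r^2). The maximum principle
  carries this bound inside, and it tends to 0 as r tends to 1.\<close>

lemma holomorphic_zero_if_vanishing_bound: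
  assumes F: "F holomorphic_on ball 0 1" and a: "norm a < 1"
    and K: "\<And>z. norm z < 1 \<Longrightarrow> norm (F z) \<le> K * (1 - (norm z)\<^sup>2)"
  shows "F a = 0"
proof -
  have b: "norm (F a) \<le> K * (1 - r\<^sup>2)" if r: "norm a < r" "r < 1" for r
  proof (rule maximum_modulus_frontier[of F "cball 0 r"])
    have r0: "0 < r" using r norm_ge_zero[of a] by linarith
    show "F holomorphic_on interior (cball 0 r)" "continuous_on (closure (cball 0 r)) F"
      using r by (auto intro!: holomorphic_on_imp_continuous_on holomorphic_on_subset[OF F])
    show "norm (F z) \<le> K * (1 - r\<^sup>2)" if "z \<in> frontier (cball 0 r)" for z
      using K[of z] that r r0 by (auto simp: frontier_cball)
  qed (use r in auto)
  have "((\<lambda>r. K * (1 - r\<^sup>2)) \<longlongrightarrow> K * (1 - 1\<^sup>2)) (at_left 1)"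
    by (intro tendsto_intros)
  moreover have "eventually (\<lambda>r. norm (F a) \<le> K * (1 - r\<^sup>2)) (at_left 1)"
    using eventually_at_left_real[OF a] by eventually_elim (use b in auto)
  ultimately have "norm (F a) \<le> K * (1 - 1\<^sup>2)"
    by (rule tendsto_lowerbound) simp
  then show ?thesis by simp
qed

text \<open>The torus is the distinguished boundary of the polydisc: the one-variable maximum
  principle releases the coordinates from their circles one at a time.\<close>

lemma polydisc_maximum_modulus:
  fixes h :: "complex^'n \<Rightarrow> complex"
  assumes h: "mhol h U" and sub: "{z. \<forall>i. norm (z $ i) \<le> t} \<subseteq> U"
    and B: "\<And>z. (\<And>i. norm (z $ i) = t) \<Longrightarrow> norm (h z) \<le> B"
    and z: "\<And>i. norm (z $ i) \<le> t"
  shows "norm (h z) \<le> B"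
proof -
  \<comment> \<open>\<open>A\<close> collects the coordinates already allowed to range over the
    whole closed disc; the others are still on the circle.\<close>
  have "\<forall>z. (\<forall>i. norm (z $ i) \<le> t) \<longrightarrow> (\<forall>i. i \<notin> A \<longrightarrow> norm (z $ i) = t) \<longrightarrow> norm (h z) \<le> B"
    if "finite A" for A
    using that
  proof (induction A)
    case empty
    then show ?case using B by auto
  next
    case (insert k A)
    show ?case
    proof (intro allI impI)
      fix z :: "complex^'n"
      assume z: "\<forall>i. norm (z $ i) \<le> t" "\<forall>i. i \<notin> insert k A \<longrightarrow> norm (z $ i) = t"
      define p where "p = (\<lambda>s. (z - axis k (z $ k)) + axis k s)"
      have p: "p s $ i = (if i = k then s else z $ i)" for s i
        by (simp add: p_def axis_def)
      have pU: "p s \<in> U" if "norm s \<le> t" for s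
        using sub z(1) that by (auto simp: p)
      have d: "((\<lambda>s. h (p s)) has_field_derivative cpartial k h (p s)) (at s)" if "norm s \<le> t" for s
        using mhol_axis_at[OF h, of "z - axis k (z $ k)" k s] pU[OF that] by (simp add: p_def)
      have c: "continuous_on (cball 0 t) (\<lambda>s. h (p s))"
        by (rule DERIV_continuous_on[where D="\<lambda>s. cpartial k h (p s)"])
           (rule has_field_derivative_at_within[OF d], simp)
      have hol: "(\<lambda>s. h (p s)) holomorphic_on ball 0 t"
        unfolding holomorphic_on_def field_differentiable_def
        by (rule ballI, rule exI, rule has_field_derivative_at_within[OF d], simp)
      have "norm (h (p (z $ k))) \<le> B"
      proof (rule maximum_modulus_frontier[of "\<lambda>s. h (p s)" "cball 0 t"])
        show "norm (h (p s)) \<le> B" if "s \<in> frontier (cball 0 t)" for s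
          using insert.IH z that by (auto simp: p frontier_cball)
      qed (use c hol z in auto)
      moreover have "p (z $ k) = z" by (simp add: p_def)
      ultimately show "norm (h z) \<le> B" by simp
    qed
  qed
  from this[of UNIV] z show ?thesis by auto
qed

section \<open>Integrability of the Schwarzian system\<close>

lemma mhol_det:
  fixes M :: "complex^'n \<Rightarrow> complex^'m^'m"
  assumes "\<And>i j. mhol (\<lambda>z. M z $ i $ j) U"
  shows "mhol (\<lambda>z. det (M z)) U"
  unfolding det_def by (intro mhol_sum mhol_mult mhol_const mhol_prod assms)

lemma cpartial_prod:
  assumes "finite A" "\<And>a. a \<in> A \<Longrightarrow> mhol (h a) U" "z \<in> U"
  shows "cpartial i (\<lambda>z. \<Prod>a\<in>A. h a z) z = (\<Sum>a\<in>A. cpartial i (h a) z * (\<Prod>b\<in>A - {a}. h b z))"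
  using assms
proof (induction A)
  case (insert x A)
  have "cpartial i (\<lambda>z. \<Prod>a\<in>insert x A. h a z) z = cpartial i (\<lambda>z. h x z * (\<Prod>a\<in>A. h a z)) z"
    using insert.hyps by simp
  also have "\<dots> = cpartial i (h x) z * (\<Prod>a\<in>A. h a z) + h x z * (\<Sum>a\<in>A. cpartial i (h a) z * (\<Prod>b\<in>A - {a}. h b z))"
    by (subst cpartial_mult[where U=U]) (use insert in \<open>auto intro: mhol_prod\<close>)
  also have "h x z * (\<Sum>a\<in>A. cpartial i (h a) z * (\<Prod>b\<in>A - {a}. h b z))
      = (\<Sum>a\<in>A. cpartial i (h a) z * (\<Prod>b\<in>insert x A - {a}. h b z))"
    unfolding sum_distrib_left
  proof (rule sum.cong)
    fix a assume a: "a \<in> A"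
    then have "insert x A - {a} = insert x (A - {a})" using insert.hyps by auto
    then show "h x z * (cpartial i (h a) z * (\<Prod>b\<in>A - {a}. h b z))
        = cpartial i (h a) z * (\<Prod>b\<in>insert x A - {a}. h b z)"
      using insert.hyps by simp
  qed simp
  finally show ?case using insert.hyps by (simp add: insert_Diff_if)
qed simp

text \<open>The product rule differentiates one factor of each Leibniz term. A permutation other
  than the identity moves at least two indices, so an off-diagonal zero survives, and only the trace
  remains.\<close>

lemma cpartial_det_at_identity:
  fixes M :: "complex^'n \<Rightarrow> complex^'m^'m"
  assumes M: "\<And>i j. mhol (\<lambda>z. M z $ i $ j) U" and z: "z \<in> U" and id: "M z = mat 1"
  shows "cpartial i (\<lambda>z. det (M z)) z = (\<Sum>k\<in>UNIV. cpartial i (\<lambda>z. M z $ k $ k) z)"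
proof -
  let ?P = "{p. p permutes (UNIV :: 'm set)}"
  let ?t = "\<lambda>p. of_int (sign p) * (\<Sum>k\<in>UNIV. cpartial i (\<lambda>z. M z $ k $ p k) z * (\<Prod>b\<in>UNIV - {k}. M z $ b $ p b))"
  have "cpartial i (\<lambda>z. det (M z)) z = (\<Sum>p\<in>?P. cpartial i (\<lambda>z. of_int (sign p) * (\<Prod>k\<in>UNIV. M z $ k $ p k)) z)"
    unfolding det_def by (rule cpartial_sum[where U=U]) (intro mhol_cmult mhol_prod M, rule z)
  also have "\<dots> = (\<Sum>p\<in>?P. ?t p)"
    by (intro sum.cong refl, subst cpartial_cmult[OF mhol_prod[OF M] z],
        subst cpartial_prod[where U=U]) (auto intro: M z)
  also have "\<dots> = (\<Sum>p\<in>{id}. ?t p)"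
  proof (rule sum.mono_neutral_right)
    show "\<forall>p\<in>?P - {id}. ?t p = 0"
    proof
      fix p assume "p \<in> ?P - {id}"
      then have p: "inj p" "p \<noteq> id" by (auto dest: permutes_inj)
      then obtain c where c: "p c \<noteq> c" by (auto simp: fun_eq_iff)
      have "(\<Prod>b\<in>UNIV - {k}. M z $ b $ p b) = 0" for k
      proof -
        \<comment> \<open>By injectivity \<open>p c\<close> is moved as well, so one of the moved
          indices \<open>c\<close> and \<open>p c\<close> differs from \<open>k\<close>.\<close>
        obtain b where "b \<noteq> k" "p b \<noteq> b"
          using c p(1) by (metis injD)
        then show ?thesis by (intro prod_zero bexI[of _ b]) (auto simp: id mat_def)
      qed
      then have "?t p = of_int (sign p) * (\<Sum>k\<in>UNIV. cpartial i (\<lambda>z. M z $ k $ p k) z * 0)"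
        by (simp only:)
      then show "?t p = 0" by simp
    qed
  qed (auto simp: permutes_id)
  also have "\<dots> = (\<Sum>k\<in>UNIV. cpartial i (\<lambda>z. M z $ k $ k) z)"
    by (simp add: id mat_def)
  finally show ?thesis .
qed

text \<open>Jacobi's formula, reduced to the identity matrix: \<open>B\<close> is the inverse of
  \<open>M\<close> at the single point \<open>z\<close> and is kept constant while
  differentiating.\<close>

lemma cpartial_det:
  fixes M :: "complex^'n \<Rightarrow> complex^'m^'m"
  assumes M: "\<And>i j. mhol (\<lambda>z. M z $ i $ j) U" and z: "z \<in> U" and B: "B ** M z = mat 1"
  shows "cpartial i (\<lambda>z. det (M z)) z = det (M z) * (\<Sum>k\<in>UNIV. \<Sum>l\<in>UNIV. B $ k $ l * cpartial i (\<lambda>z. M z $ l $ k) z)"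
proof -
  have e: "(B ** M z) $ k $ j = (\<Sum>l\<in>UNIV. B $ k $ l * M z $ l $ j)" for k j z
    by (simp add: matrix_matrix_mult_def)
  have N: "mhol (\<lambda>z. (B ** M z) $ k $ j) U" for k j
    unfolding e by (intro mhol_sum mhol_cmult M)
  have d: "det B * det (M z) = 1"
    using B by (metis det_I det_mul)
  have "det B * cpartial i (\<lambda>z. det (M z)) z = cpartial i (\<lambda>z. det (B ** M z)) z"
    unfolding det_mul by (rule cpartial_cmult[OF mhol_det[OF M] z, symmetric])
  also have "\<dots> = (\<Sum>k\<in>UNIV. cpartial i (\<lambda>z. (B ** M z) $ k $ k) z)"
    by (rule cpartial_det_at_identity[OF N z B])
  also have "\<dots> = (\<Sum>k\<in>UNIV. \<Sum>l\<in>UNIV. B $ k $ l * cpartial i (\<lambda>z. M z $ l $ k) z)"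
    unfolding e
    by (intro sum.cong refl, subst cpartial_sum[where U=U])
       (auto intro!: mhol_cmult M z sum.cong cpartial_cmult[OF M z])
  finally have "det (M z) * (det B * cpartial i (\<lambda>z. det (M z)) z) = det (M z) * (\<Sum>k\<in>UNIV. \<Sum>l\<in>UNIV. B $ k $ l * cpartial i (\<lambda>z. M z $ l $ k) z)"
    by simp
  then show ?thesis using d by (simp add: mult.assoc[symmetric] mult.commute)
qed

lemma matrix_inv_nonsingular:
  fixes A :: "complex^'n^'n"
  assumes "det A \<noteq> 0"
  shows "A ** matrix_inv A = mat 1" "matrix_inv A ** A = mat 1"
proof -
  have "\<exists>B. A ** B = mat 1 \<and> B ** A = mat 1"
    using assms by (simp add: invertible_det_nz[symmetric] invertible_def)
  from someI_ex[OF this] show "A ** matrix_inv A = mat 1" "matrix_inv A ** A = mat 1"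
    by (simp_all add: matrix_inv_def)
qed

text \<open>Turns entries of the inverse into quotients of determinants, from which their holomorphy
  is immediate.\<close>

lemma matrix_inv_cramer:
  fixes A :: "complex^'n^'n"
  assumes "det A \<noteq> 0"
  shows "matrix_inv A $ k $ l = det (\<chi> i j. if j = k then (\<chi> i. if i = l then 1 else 0) $ i else A $ i $ j) / det A"
proof -
  have inv: "A ** matrix_inv A = mat 1"
    by (rule matrix_inv_nonsingular(1)[OF assms])
  let ?x = "\<chi> k. matrix_inv A $ k $ l"
  have "(A *v ?x) $ i = (A ** matrix_inv A) $ i $ l" for i
    by (simp add: matrix_vector_mult_def matrix_matrix_mult_def)
  then have "A *v ?x = (\<chi> i. if i = l then 1 else 0)"
    by (simp add: vec_eq_iff inv mat_def)
  with cramer[OF assms, of ?x "\<chi> i. if i = l then 1 else 0"]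
  have "?x = (\<chi> k. det (\<chi> i j. if j = k then (\<chi> i. if i = l then 1 else 0) $ i else A $ i $ j) / det A)"
    by simp
  then have "?x $ k = (\<chi> k. det (\<chi> i j. if j = k then (\<chi> i. if i = l then 1 else 0) $ i else A $ i $ j) / det A) $ k"
    by (rule arg_cong)
  then show ?thesis by (simp only: vec_lambda_beta)
qed

lemma mhol_matrix_inv:
  fixes M :: "complex^'n \<Rightarrow> complex^'m^'m"
  assumes M: "\<And>i j. mhol (\<lambda>z. M z $ i $ j) U" and nz: "\<And>z. z \<in> U \<Longrightarrow> det (M z) \<noteq> 0" and U: "open U"
  shows "mhol (\<lambda>z. matrix_inv (M z) $ k $ l) U"
proof (rule mhol_cong[OF U])
  let ?N = "\<lambda>z. \<chi> i j. if j = k then (\<chi> i. if i = l then 1 else 0) $ i else M z $ i $ j"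
  show "det (?N z) / det (M z) = matrix_inv (M z) $ k $ l" if "z \<in> U" for z
    using matrix_inv_cramer[OF nz[OF that]] by simp
  have "mhol (\<lambda>z. ?N z $ i $ j) U" for i j
    by (cases "j = k") (auto intro: M mhol_const)
  then show "mhol (\<lambda>z. det (?N z) / det (M z)) U"
    by (intro mhol_divide mhol_det M nz)
qed

lemma open_polydisc: "open (polydisc :: (complex^'n) set)"
proof -
  have "(polydisc :: (complex^'n) set) = (\<Inter>i. {z. norm (z $ i) < 1})"
    by (auto simp: polydisc_def)
  moreover have "open {z :: complex^'n. norm (z $ i) < 1}" for i
    by (intro open_Collect_less continuous_intros)
  then have "open (\<Inter>i. {z :: complex^'n. norm (z $ i) < 1})" by (intro open_INT) auto
  ultimately show ?thesis by (simp only:)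
qed

section \<open>Schwarzian derivatives of a locally biholomorphic map and their integrability
  conditions\<close>

locale locally_biholomorphic =
  fixes f :: "complex^'n \<Rightarrow> complex^'n"
  assumes lb: "locally_biholomorphic_on f polydisc"
begin

definition J where "J z = cjacobian_det f z"

text \<open>Christoffel symbols of the flat connection pulled back by \<open>f\<close>: they express
  the second derivatives of the components through the first ones (see \<open>G_eq\<close>).\<close>

definition G where
  "G k i j z = (\<Sum>l\<in>UNIV. cpartial i (cpartial j (\<lambda>w. f w $ l)) z * matrix_inv (cjacobian f z) $ k $ l)"

text \<open>The logarithmic gradient of J^(-1/(n+1)), written without choosing a root.\<close>

definition p where "p i z = - (1 / of_nat (CARD('n) + 1)) * (cpartial i J z * inverse (J z))"

abbreviation S where "S \<equiv> schwarzian_deriv f"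

lemma mhol_component: "mhol (\<lambda>w. f w $ l) polydisc"
proof (rule mholI)
  fix z :: "complex^'n" assume "z \<in> polydisc"
  then obtain V where "z \<in> V" "biholomorphic_on f V"
    using lb unfolding locally_biholomorphic_on_def by blast
  then obtain A :: "complex^'n^'n" where A: "(f has_derivative (\<lambda>h. A *v h)) (at z)"
    unfolding biholomorphic_on_def cn_holomorphic_on_def by blast
  have "((\<lambda>w. f w $ l) has_derivative (\<lambda>h. (A *v h) $ l)) (at z)"
    using bounded_linear.has_derivative[OF bounded_linear_vec_nth A] .
  then have "((\<lambda>w. f w $ l) has_derivative (\<lambda>v. \<Sum>i\<in>UNIV. A $ l $ i * v $ i)) (at z)"
    by (simp add: matrix_vector_mult_def)
  note d = this
  then show "((\<lambda>w. f w $ l) has_derivative (\<lambda>v. \<Sum>i\<in>UNIV. cpartial i (\<lambda>w. f w $ l) z * v $ i)) (at z)"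
    unfolding cpartial_eq[OF d] .
qed

lemma det_cjacobian_nonzero:
  assumes z: "z \<in> polydisc"
  shows "det (cjacobian f z) \<noteq> 0"
proof -
  obtain V where V: "z \<in> V" "biholomorphic_on f V"
    using lb z unfolding locally_biholomorphic_on_def by blast
  obtain A :: "complex^'n^'n" where A: "(f has_derivative (\<lambda>h. A *v h)) (at z)"
    using V unfolding biholomorphic_on_def cn_holomorphic_on_def by blast
  obtain B :: "complex^'n^'n" where B: "(inv_into V f has_derivative (\<lambda>h. B *v h)) (at (f z))"
    using V unfolding biholomorphic_on_def cn_holomorphic_on_def by blast
  have "((\<lambda>w. inv_into V f (f w)) has_derivative (\<lambda>h. B *v (A *v h))) (at z)"
    using has_derivative_compose[OF A B] .
  then have "((\<lambda>w. w) has_derivative (\<lambda>h. B *v (A *v h))) (at z)"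
  proof (rule has_derivative_transform_within_open)
    show "open V" "z \<in> V" using V by (simp_all add: biholomorphic_on_def)
    show "inv_into V f (f w) = w" if "w \<in> V" for w
      using V that by (simp add: biholomorphic_on_def)
  qed
  from has_derivative_unique[OF has_derivative_ident this]
  have "(\<lambda>h. h) = (\<lambda>h. B *v (A *v h))" .
  then have "(B ** A) *v h = mat 1 *v h" for h
    by (simp add: matrix_vector_mul_assoc[symmetric] fun_eq_iff)
  then have "B ** A = mat 1" by (simp add: matrix_eq)
  then have "det B * det A = 1" by (metis det_I det_mul)
  then have "det A \<noteq> 0" by auto
  moreover have "cjacobian f z = A"
  proof -
    have "((\<lambda>w. f w $ l) has_derivative (\<lambda>v. \<Sum>i\<in>UNIV. A $ l $ i * v $ i)) (at z)" for l
      using bounded_linear.has_derivative[OF bounded_linear_vec_nth A, of l]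
      by (simp add: matrix_vector_mult_def)
    from cpartial_eq[OF this] show ?thesis by (simp add: cjacobian_def vec_eq_iff)
  qed
  ultimately show ?thesis by simp
qed

lemma J_nonzero: "z \<in> polydisc \<Longrightarrow> J z \<noteq> 0"
  by (simp add: J_def cjacobian_det_def det_cjacobian_nonzero)

lemma cjacobian_nth: "cjacobian f z $ l $ i = cpartial i (\<lambda>w. f w $ l) z"
  by (simp add: cjacobian_def)

lemma matrix_inv_cjacobian:
  assumes "z \<in> polydisc"
  shows "cjacobian f z ** matrix_inv (cjacobian f z) = mat 1"
    "matrix_inv (cjacobian f z) ** cjacobian f z = mat 1"
  using det_cjacobian_nonzero[OF assms]
  by (simp_all add: matrix_inv_nonsingular)

lemma mhol_dcomponent: "mhol (cpartial i (\<lambda>w. f w $ l)) polydisc"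
  by (intro mhol_cpartial open_polydisc mhol_component)

lemma mhol_cjacobian: "mhol (\<lambda>z. cjacobian f z $ l $ i) polydisc"
  unfolding cjacobian_nth by (rule mhol_dcomponent)

lemma mhol_J: "mhol J polydisc"
proof -
  have "J = (\<lambda>z. det (cjacobian f z))" by (rule ext) (simp add: J_def cjacobian_det_def)
  then show ?thesis using mhol_det[OF mhol_cjacobian] by simp
qed

lemma mhol_G: "mhol (G k i j) polydisc"
proof -
  have "G k i j = (\<lambda>z. \<Sum>l\<in>UNIV. cpartial i (cpartial j (\<lambda>w. f w $ l)) z * matrix_inv (cjacobian f z) $ k $ l)"
    by (rule ext) (simp add: G_def)
  then show ?thesis
    by (simp only:) (intro mhol_sum mhol_mult mhol_cpartial open_polydisc mhol_component
        mhol_matrix_inv mhol_cjacobian det_cjacobian_nonzero)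
qed

lemma mhol_p: "mhol (p i) polydisc"
proof -
  have "p i = (\<lambda>z. - (1 / of_nat (CARD('n) + 1)) * (cpartial i J z * inverse (J z)))"
    by (rule ext) (simp add: p_def)
  then show ?thesis
    by (simp only:) (intro mhol_cmult mhol_mult mhol_inverse mhol_cpartial mhol_J J_nonzero open_polydisc)
qed

lemma G_sym:
  assumes "z \<in> polydisc"
  shows "G k i j z = G k j i z"
  unfolding G_def by (intro sum.cong refl, subst cpartial_commute[OF open_polydisc mhol_component assms]) simp

lemma G_eq:
  assumes "z \<in> polydisc"
  shows "cpartial i (cpartial j (\<lambda>w. f w $ l)) z = (\<Sum>k\<in>UNIV. G k i j z * cpartial k (\<lambda>w. f w $ l) z)"
proof -
  let ?H = "\<lambda>m. cpartial i (cpartial j (\<lambda>w. f w $ m)) z" and ?A = "cjacobian f z"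
  have "(\<Sum>k\<in>UNIV. G k i j z * cpartial k (\<lambda>w. f w $ l) z)
      = (\<Sum>k\<in>UNIV. \<Sum>m\<in>UNIV. ?H m * (?A $ l $ k * matrix_inv ?A $ k $ m))"
    unfolding G_def cjacobian_nth by (simp add: sum_distrib_right sum_distrib_left mult_ac)
  also have "\<dots> = (\<Sum>m\<in>UNIV. ?H m * (?A ** matrix_inv ?A) $ l $ m)"
    by (subst sum.swap) (simp add: matrix_matrix_mult_def sum_distrib_left)
  also have "\<dots> = ?H l"
    unfolding matrix_inv_cjacobian(1)[OF assms] mat_def by (simp add: if_distrib cong: if_cong)
  finally show ?thesis by simp
qed

lemma cpartial_J:
  assumes "z \<in> polydisc"
  shows "cpartial i J z = J z * (\<Sum>k\<in>UNIV. G k i k z)"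
proof -
  have "J = (\<lambda>z. det (cjacobian f z))" by (rule ext) (simp add: J_def cjacobian_det_def)
  moreover have "(\<lambda>z. cjacobian f z $ l $ k) = cpartial k (\<lambda>w. f w $ l)" for l k
    by (simp add: cjacobian_nth)
  ultimately show ?thesis
    using cpartial_det[OF mhol_cjacobian assms matrix_inv_cjacobian(2)[OF assms], of i]
    by (simp add: G_def mult.commute)
qed

lemma p_eq_trace:
  assumes "z \<in> polydisc"
  shows "(\<Sum>k\<in>UNIV. G k i k z) = - (of_nat (CARD('n) + 1) * p i z)"
  using J_nonzero[OF assms] by (simp add: p_def cpartial_J[OF assms] field_simps del: of_nat_add of_nat_Suc)

lemma cpartial_p_sym:
  assumes z: "z \<in> polydisc"
  shows "cpartial j (p i) z = cpartial i (p j) z"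
proof -
  note h = mhol_cpartial[OF open_polydisc mhol_J] mhol_inverse[OF mhol_J J_nonzero] mhol_J
  have "cpartial j (p i) z = - (1 / of_nat (CARD('n) + 1)) * (cpartial j (cpartial i J) z * inverse (J z)
      + cpartial i J z * - (inverse (J z) * cpartial j J z * inverse (J z)))" for i j
  proof -
    have "p i = (\<lambda>z. - (1 / of_nat (CARD('n) + 1)) * (cpartial i J z * inverse (J z)))"
      by (rule ext) (simp add: p_def)
    then show ?thesis
      by (simp only: cpartial_cmult[OF mhol_mult[OF h(1,2)] z] cpartial_mult[OF h(1,2) z]
          cpartial_inverse[OF h(3) z J_nonzero[OF z]])
  qed
  then show ?thesis
    by (simp add: cpartial_commute[OF open_polydisc mhol_J z, of i j])
qed

lemma S_eq: "S k i j z = G k i j z + (if k = i then p j z else 0) + (if k = j then p i z else 0)"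
proof -
  have J: "cjacobian_det f = J" by (rule ext) (simp add: J_def)
  show ?thesis
    unfolding schwarzian_deriv_def J log_cpartial_def G_def p_def by (simp add: field_simps)
qed

lemma mhol_S: "mhol (S k i j) polydisc"
proof -
  have "S k i j = (\<lambda>z. G k i j z + (if k = i then p j z else 0) + (if k = j then p i z else 0))"
    by (rule ext) (rule S_eq)
  moreover have h: "mhol (\<lambda>z. if b then p i z else 0) polydisc" for b i
    by (cases b) (auto intro: mhol_p mhol_const)
  have "mhol (\<lambda>z. G k i j z + (if k = i then p j z else 0) + (if k = j then p i z else 0)) polydisc"
    by (intro mhol_add mhol_G h)
  ultimately show ?thesis by (simp only:)
qed

lemma S_sym: "z \<in> polydisc \<Longrightarrow> S k i j z = S k j i z"
  by (auto simp: S_eq G_sym[of z k i j])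

text \<open>The trace of \<open>G\<close> is -(n+1) \<open>p i z\<close> by Jacobi's formula, and
  the two correction terms of \<open>S_eq\<close> contribute \<open>p i z\<close> and n times
  \<open>p i z\<close>. So \<open>S\<close> is the trace-free part of \<open>G\<close>.\<close>

lemma S_trace:
  assumes "z \<in> polydisc"
  shows "(\<Sum>k\<in>UNIV. S k i k z) = 0"
  by (simp add: S_eq sum.distrib p_eq_trace[OF assms] algebra_simps)

text \<open>Flatness of the connection \<open>G\<close>: the third derivatives of every component of
  \<open>f\<close> are symmetric, and the invertible Jacobian can be cancelled.\<close>

lemma G_integrability:
  assumes z: "z \<in> polydisc"
  shows "cpartial m (G r i j) z + (\<Sum>k\<in>UNIV. G k i j z * G r k m z)
       = cpartial j (G r i m) z + (\<Sum>k\<in>UNIV. G k i m z * G r k j z)"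
proof -
  \<comment> \<open>\<open>E m j r\<close> is the coefficient of the third derivative in direction
    i, j, m with respect to the columns of the Jacobian.\<close>
  define E where "E = (\<lambda>m j r. cpartial m (G r i j) z + (\<Sum>k\<in>UNIV. G k i j z * G r k m z))"
  have third: "cpartial m (cpartial j (cpartial i (\<lambda>w. f w $ l))) z = (\<Sum>r\<in>UNIV. cjacobian f z $ l $ r * E m j r)" for m j l
  proof -
    have "cpartial m (cpartial j (cpartial i (\<lambda>w. f w $ l))) z
        = cpartial m (\<lambda>z. \<Sum>k\<in>UNIV. G k i j z * cpartial k (\<lambda>w. f w $ l) z) z"
      by (rule cpartial_cong_open[OF open_polydisc z])
         (auto intro!: mhol_cpartial open_polydisc mhol_component simp: G_eq G_sym[of _ _ i j])
    also have "\<dots> = (\<Sum>k\<in>UNIV. cpartial m (G k i j) z * cpartial k (\<lambda>w. f w $ l) z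
        + G k i j z * (\<Sum>r\<in>UNIV. G r m k z * cpartial r (\<lambda>w. f w $ l) z))"
      by (subst cpartial_sum[OF mhol_mult[OF mhol_G mhol_dcomponent] z])
         (intro sum.cong refl, subst cpartial_mult[OF mhol_G mhol_dcomponent z], subst G_eq[OF z], rule refl)
    also have "\<dots> = (\<Sum>r\<in>UNIV. cpartial m (G r i j) z * cpartial r (\<lambda>w. f w $ l) z)
        + (\<Sum>k\<in>UNIV. \<Sum>r\<in>UNIV. G k i j z * G r k m z * cpartial r (\<lambda>w. f w $ l) z)"
      by (simp add: sum.distrib sum_distrib_left mult.assoc G_sym[OF z, of _ m])
    also have "\<dots> = (\<Sum>r\<in>UNIV. cjacobian f z $ l $ r * E m j r)"
      by (subst sum.swap) (simp add: E_def cjacobian_nth sum_distrib_right sum_distrib_left distrib_left sum.distrib mult_ac)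
    finally show ?thesis .
  qed
  have "cjacobian f z *v (\<chi> r. E m j r) = cjacobian f z *v (\<chi> r. E j m r)"
    using third[of m j] third[of j m] cpartial_commute[OF open_polydisc mhol_dcomponent z, of m j i]
    by (simp add: vec_eq_iff matrix_vector_mult_def)
  then have "matrix_inv (cjacobian f z) *v (cjacobian f z *v (\<chi> r. E m j r))
      = matrix_inv (cjacobian f z) *v (cjacobian f z *v (\<chi> r. E j m r))" by simp
  then have "(\<chi> r. E m j r) = (\<chi> r. E j m r)"
    by (simp add: matrix_vector_mul_assoc matrix_inv_cjacobian(2)[OF z])
  then have "E m j r = E j m r" by (simp add: vec_eq_iff)
  then show ?thesis by (simp add: E_def)
qed

text \<open>With u = J^(-1/(n+1)) one has d_j d_i u / u = d_j p_i + p_i p_j, so this is the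
  zeroth-order coefficient that makes u itself a solution of the linear system.\<close>

definition Q where "Q i j z = cpartial j (p i) z + p i z * p j z - (\<Sum>k\<in>UNIV. S k i j z * p k z)"

lemma G_eq_S: "G k i j z = S k i j z - (if k = i then p j z else 0) - (if k = j then p i z else 0)"
  by (simp add: S_eq)

lemma cpartial_G:
  assumes z: "z \<in> polydisc"
  shows "cpartial m (G k i j) z = cpartial m (S k i j) z
    - (if k = i then cpartial m (p j) z else 0) - (if k = j then cpartial m (p i) z else 0)"
proof -
  have "G k i j = (\<lambda>z. S k i j z - (if k = i then p j z else 0) - (if k = j then p i z else 0))"
    by (rule ext) (rule G_eq_S)
  moreover have h: "mhol (\<lambda>z. if b then p i z else 0) polydisc" for b i
    by (cases b) (auto intro: mhol_p mhol_const)
  moreover have "cpartial m (\<lambda>z. if b then p i z else 0) z = (if b then cpartial m (p i) z else 0)" for b i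
    by (cases b) auto
  ultimately show ?thesis
    by (simp only: cpartial_diff[OF mhol_diff[OF mhol_S h] h z] cpartial_diff[OF mhol_S h z])
qed

text \<open>Contract \<open>G_integrability\<close> over r = m and replace \<open>G\<close> by
  \<open>S\<close> and \<open>p\<close>. The traces of \<open>S\<close> drop out, and everything
  containing \<open>p\<close> or its derivatives collects into n - 1 copies of \<open>Q\<close>.
  Bounds on \<open>S\<close> alone therefore control \<open>Q\<close>, although \<open>p\<close> has
  no a priori bound.\<close>

lemma Q_eq:
  assumes z: "z \<in> polydisc"
  shows "(of_nat CARD('n) - 1) * Q i j z =
    (\<Sum>m\<in>UNIV. \<Sum>k\<in>UNIV. S k i m z * S m k j z) - (\<Sum>m\<in>UNIV. cpartial m (S m i j) z)"
proof -
  let ?n = "of_nat CARD('n) :: complex"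
  define D where "D = (\<Sum>m\<in>UNIV. cpartial m (S m i j) z)"
  define SP where "SP = (\<Sum>k\<in>UNIV. S k i j z * p k z)"
  define SS where "SS = (\<Sum>m\<in>UNIV. \<Sum>k\<in>UNIV. S k i m z * S m k j z)"
  define dp where "dp = cpartial j (p i) z"
  have C: "(\<Sum>m\<in>UNIV. cpartial m (G m i j) z) + (\<Sum>m\<in>UNIV. \<Sum>k\<in>UNIV. G k i j z * G m k m z)
      = (\<Sum>m\<in>UNIV. cpartial j (G m i m) z) + (\<Sum>m\<in>UNIV. \<Sum>k\<in>UNIV. G k i m z * G m k j z)"
    using G_integrability[OF z] by (simp add: sum.distrib[symmetric])
  have A1: "(\<Sum>m\<in>UNIV. cpartial m (G m i j) z) = D - 2 * dp"
    by (simp add: cpartial_G[OF z] sum_subtractf D_def dp_def cpartial_p_sym[OF z, of i j])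
  have "(\<Sum>m\<in>UNIV. \<Sum>k\<in>UNIV. G k i j z * G m k m z) = (\<Sum>k\<in>UNIV. G k i j z * (\<Sum>m\<in>UNIV. G m k m z))"
    by (subst sum.swap) (simp add: sum_distrib_left)
  also have "\<dots> = - (?n + 1) * (\<Sum>k\<in>UNIV. G k i j z * p k z)"
    unfolding p_eq_trace[OF z] sum_distrib_left by (intro sum.cong) (auto simp: algebra_simps)
  also have "(\<Sum>k\<in>UNIV. G k i j z * p k z) = (\<Sum>k\<in>UNIV. S k i j z * p k z
      - (if k = i then p j z * p k z else 0) - (if k = j then p i z * p k z else 0))"
    by (intro sum.cong) (auto simp: G_eq_S algebra_simps)
  also have "\<dots> = SP - 2 * (p i z * p j z)"
    by (simp add: sum_subtractf SP_def)
  finally have A2: "(\<Sum>m\<in>UNIV. \<Sum>k\<in>UNIV. G k i j z * G m k m z) = - (?n + 1) * (SP - 2 * (p i z * p j z))" .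
  have "(\<Sum>m\<in>UNIV. cpartial j (G m i m) z) = cpartial j (\<lambda>z. \<Sum>m\<in>UNIV. G m i m z) z"
    by (rule cpartial_sum[OF mhol_G z, symmetric])
  also have "\<dots> = cpartial j (\<lambda>z. - (?n + 1) * p i z) z"
    by (rule cpartial_cong_open[OF open_polydisc z _ mhol_sum[OF mhol_G]])
       (simp add: p_eq_trace algebra_simps)
  also have "\<dots> = - (?n + 1) * dp"
    unfolding dp_def by (rule cpartial_cmult[OF mhol_p z])
  finally have A3: "(\<Sum>m\<in>UNIV. cpartial j (G m i m) z) = - (?n + 1) * dp" .
  \<comment> \<open>The nine products of the two three-term expansions, with nested conditionals so
    that the double sums collapse. The condition k = m alone leaves a free index and produces the
    factor n.\<close>
  have "(\<Sum>m\<in>UNIV. \<Sum>k\<in>UNIV. G k i m z * G m k j z) = (\<Sum>m\<in>UNIV. \<Sum>k\<in>UNIV. S k i m z * S m k j z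
      - (if k = m then S m i m z * p j z else 0)
      - (if m = j then S k i j z * p k z else 0)
      - (if k = i then S m i j z * p m z else 0)
      + (if k = i then (if m = i then p i z * p j z else 0) else 0)
      + (if k = i then (if m = j then p i z * p j z else 0) else 0)
      - (if k = m then S m m j z * p i z else 0)
      + (if k = m then p i z * p j z else 0)
      + (if k = m then (if m = j then p i z * p j z else 0) else 0))"
    by (intro sum.cong refl) (auto simp: G_eq_S algebra_simps)
  also have "\<dots> = SS - (\<Sum>m\<in>UNIV. S m i m z * p j z) - SP - SP + p i z * p j z + p i z * p j z
      - (\<Sum>m\<in>UNIV. S m m j z * p i z) + ?n * (p i z * p j z) + p i z * p j z"
  proof -
    have "(\<Sum>m\<in>UNIV. \<Sum>k\<in>UNIV. if m = j then S k i j z * p k z else 0) = SP"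
      by (subst sum.swap) (simp add: SP_def)
    then show ?thesis by (simp add: sum.distrib sum_subtractf SS_def SP_def sum_distrib_left[symmetric])
  qed
  also have "(\<Sum>m\<in>UNIV. S m i m z * p j z) = 0"
    using S_trace[OF z, of i] by (simp add: sum_distrib_right[symmetric])
  also have "(\<Sum>m\<in>UNIV. S m m j z * p i z) = 0"
    using S_trace[OF z, of j] by (simp add: sum_distrib_right[symmetric] S_sym[OF z, of _ _ j])
  finally have A4: "(\<Sum>m\<in>UNIV. \<Sum>k\<in>UNIV. G k i m z * G m k j z) = SS - 2 * SP + (?n + 3) * (p i z * p j z)"
    by (simp add: algebra_simps)
  have "(?n - 1) * (dp + p i z * p j z - SP) = SS - D"
    using C unfolding A1 A2 A3 A4 by (simp add: algebra_simps)
  then show ?thesis by (simp add: Q_def dp_def SP_def SS_def D_def)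
qed

section \<open>The denominator of the projective map and the Riccati system\<close>

definition L where "L a z = 1 + (\<Sum>l\<in>UNIV. a $ l * f z $ l)"

text \<open>The logarithmic gradient of \<open>J^(-1/(n+1)) * L a\<close>, which needs no branch of the root.\<close>

definition w where "w a i z = cpartial i (L a) z * inverse (L a z) + p i z"

lemma mhol_L: "mhol (L a) polydisc"
proof -
  have "L a = (\<lambda>z. 1 + (\<Sum>l\<in>UNIV. a $ l * f z $ l))" by (rule ext) (simp add: L_def)
  then show ?thesis by (simp only:) (intro mhol_add mhol_const mhol_sum mhol_cmult mhol_component)
qed

lemma cpartial_L:
  assumes z: "z \<in> polydisc"
  shows "cpartial i (L a) z = (\<Sum>l\<in>UNIV. a $ l * cpartial i (\<lambda>w. f w $ l) z)"
proof -
  have "L a = (\<lambda>z. 1 + (\<Sum>l\<in>UNIV. a $ l * f z $ l))" by (rule ext) (simp add: L_def)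
  then show ?thesis
    by (simp add: cpartial_add[OF mhol_const mhol_sum[OF mhol_cmult[OF mhol_component]] z]
        cpartial_sum[OF mhol_cmult[OF mhol_component] z] cpartial_cmult[OF mhol_component z])
qed

text \<open>An affine function of \<open>f\<close> inherits the second-order equation of the
  components of \<open>f\<close>, since the constant term has no derivatives.\<close>

lemma cpartial_cpartial_L:
  assumes z: "z \<in> polydisc"
  shows "cpartial j (cpartial i (L a)) z = (\<Sum>k\<in>UNIV. G k i j z * cpartial k (L a) z)"
proof -
  have "cpartial j (cpartial i (L a)) z = cpartial j (\<lambda>z. \<Sum>l\<in>UNIV. a $ l * cpartial i (\<lambda>w. f w $ l) z) z"
    by (rule cpartial_cong_open[OF open_polydisc z cpartial_L mhol_cpartial[OF open_polydisc mhol_L]])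
  also have "\<dots> = (\<Sum>l\<in>UNIV. \<Sum>k\<in>UNIV. a $ l * (G k i j z * cpartial k (\<lambda>w. f w $ l) z))"
    by (simp add: cpartial_sum[OF mhol_cmult[OF mhol_dcomponent] z] cpartial_cmult[OF mhol_dcomponent z]
        G_eq[OF z] G_sym[OF z, of _ j] sum_distrib_left)
  also have "\<dots> = (\<Sum>k\<in>UNIV. G k i j z * cpartial k (L a) z)"
    by (subst sum.swap) (simp add: cpartial_L[OF z] sum_distrib_left mult_ac)
  finally show ?thesis .
qed

lemma mhol_w:
  assumes "U \<subseteq> polydisc" "\<And>z. z \<in> U \<Longrightarrow> L a z \<noteq> 0"
  shows "mhol (w a i) U"
proof -
  have "w a i = (\<lambda>z. cpartial i (L a) z * inverse (L a z) + p i z)" by (rule ext) (simp add: w_def)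
  then show ?thesis
    by (simp only:) (intro mhol_add mhol_mult mhol_inverse assms(2) mhol_subset[OF _ assms(1)]
        mhol_cpartial open_polydisc mhol_L mhol_p)
qed

text \<open>Exchanging \<open>G\<close> for \<open>S\<close> creates mixed products of
  \<open>p\<close> with the logarithmic derivative of \<open>L\<close>. Together with the square
  from the quotient rule they complete \<open>w a i z * w a j z\<close> up to p_i p_j, which
  \<open>Q\<close> absorbs.\<close>

lemma riccati:
  assumes U: "U \<subseteq> polydisc" "\<And>z. z \<in> U \<Longrightarrow> L a z \<noteq> 0" and zU: "z \<in> U"
  shows "cpartial j (w a i) z = (\<Sum>k\<in>UNIV. S k i j z * w a k z) + Q i j z - w a i z * w a j z"
proof -
  let ?I = "inverse (L a z)" and ?d = "\<lambda>i. cpartial i (L a) z"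
  have z: "z \<in> polydisc" using U(1) zU by auto
  note h = mhol_subset[OF mhol_cpartial[OF open_polydisc mhol_L] U(1)]
    mhol_inverse[OF mhol_subset[OF mhol_L U(1)] U(2)] mhol_subset[OF mhol_L U(1)] mhol_subset[OF mhol_p U(1)]
  have "w a i = (\<lambda>z. cpartial i (L a) z * inverse (L a z) + p i z)" by (rule ext) (simp add: w_def)
  then have d1: "cpartial j (w a i) z = (\<Sum>k\<in>UNIV. G k i j z * ?d k) * ?I + ?d i * - (?I * ?d j * ?I) + cpartial j (p i) z"
    by (simp add: cpartial_add[OF mhol_mult[OF h(1,2)] h(4) zU] cpartial_mult[OF h(1,2) zU]
          cpartial_inverse[OF h(3) zU U(2)[OF zU]] cpartial_cpartial_L[OF z])
  have d2: "(\<Sum>k\<in>UNIV. G k i j z * ?d k) = (\<Sum>k\<in>UNIV. S k i j z * ?d k) - p j z * ?d i - p i z * ?d j"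
  proof -
    have "(\<Sum>k\<in>UNIV. G k i j z * ?d k) = (\<Sum>k\<in>UNIV. S k i j z * ?d k
      - (if k = i then p j z * ?d k else 0) - (if k = j then p i z * ?d k else 0))"
      by (intro sum.cong) (auto simp: G_eq_S algebra_simps)
    then show ?thesis by (simp add: sum_subtractf)
  qed
  have d3: "(\<Sum>k\<in>UNIV. S k i j z * w a k z) = (\<Sum>k\<in>UNIV. S k i j z * ?d k) * ?I + (\<Sum>k\<in>UNIV. S k i j z * p k z)"
    by (simp add: w_def distrib_left sum.distrib sum_distrib_left mult_ac)
  show ?thesis
    unfolding d1 d2 d3 Q_def by (simp add: w_def algebra_simps)
qed

end

section \<open>Estimates of the Schwarzian derivatives\<close>

lemma norm_vec_power2: "(norm (v :: complex^'n))\<^sup>2 = (\<Sum>i\<in>UNIV. (norm (v $ i))\<^sup>2)"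
  by (simp add: norm_vec_def L2_set_def sum_nonneg)

lemma norm_cauchy_schwarz_complex:
  fixes a b :: "complex^'n"
  shows "norm (\<Sum>k\<in>UNIV. a $ k * b $ k) \<le> norm a * norm b"
proof -
  have "norm (\<Sum>k\<in>UNIV. a $ k * b $ k) \<le> (\<Sum>k\<in>UNIV. \<bar>norm (a $ k)\<bar> * \<bar>norm (b $ k)\<bar>)"
    by (rule order_trans[OF norm_sum]) (simp add: norm_mult)
  also have "\<dots> \<le> norm a * norm b"
    unfolding norm_vec_def by (rule L2_set_mult_ineq)
  finally show ?thesis .
qed

lemma norm_vec_le_component:
  fixes v :: "complex^'n"
  assumes "\<And>i. norm (v $ i) \<le> c"
  shows "norm v \<le> sqrt (real CARD('n)) * c"
proof -
  have c: "0 \<le> c" using assms order_trans[OF norm_ge_zero] by blast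
  have "(norm v)\<^sup>2 \<le> (\<Sum>i\<in>(UNIV::'n set). c\<^sup>2)"
    unfolding norm_vec_power2 by (intro sum_mono power_mono assms) auto
  also have "\<dots> = (sqrt (real CARD('n)) * c)\<^sup>2" by (simp add: power_mult_distrib)
  finally show ?thesis by (rule power2_le_imp_le) (use c in auto)
qed

lemma norm_vec_unimodular:
  fixes v :: "complex^'n"
  assumes "\<And>i. norm (v $ i) = 1"
  shows "norm v = sqrt (real CARD('n))"
  by (simp add: norm_vec_def L2_set_def assms)

lemma parallelogram_norm:
  fixes x y :: "'a::real_inner"
  shows "(norm (x + y))\<^sup>2 + (norm (x - y))\<^sup>2 = 2 * (norm x)\<^sup>2 + 2 * (norm y)\<^sup>2"
  by (simp add: power2_norm_eq_inner inner_add_left inner_add_right inner_diff_left inner_diff_right)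

text \<open>Polarisation loses no constant in an inner product space: by the parallelogram law the
  mean of the squared norms appears, which is 1 after normalising both vectors.\<close>

lemma symmetric_bilinear_bound:
  fixes B :: "'a::euclidean_space \<Rightarrow> 'a \<Rightarrow> 'b::real_normed_vector"
  assumes B: "bilinear B" and sym: "\<And>x y. B x y = B y x"
    and M: "\<And>x. norm (B x x) \<le> M * (norm x)\<^sup>2"
  shows "norm (B x y) \<le> M * norm x * norm y"
proof (cases "x = 0 \<or> y = 0")
  case True
  then show ?thesis using bilinear_lzero[OF B] bilinear_rzero[OF B] by auto
next
  case False
  have half: "norm (B x y) \<le> M / 2 * ((norm x)\<^sup>2 + (norm y)\<^sup>2)" for x y
  proof -
    have "B (x + y) (x + y) - B (x - y) (x - y) = 4 *\<^sub>R B x y"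
    proof -
      have "4 *\<^sub>R B x y = (2 + 2) *\<^sub>R B x y" by simp
      then have four: "4 *\<^sub>R B x y = B x y + B x y + (B x y + B x y)"
        by (simp only: scaleR_add_left scaleR_2)
      show ?thesis
        unfolding four
        by (simp add: bilinear_ladd[OF B] bilinear_radd[OF B] bilinear_lsub[OF B] bilinear_rsub[OF B] sym[of y x])
    qed
    then have "4 * norm (B x y) = norm (B (x + y) (x + y) - B (x - y) (x - y))" by simp
    also have "\<dots> \<le> norm (B (x + y) (x + y)) + norm (B (x - y) (x - y))" by (rule norm_triangle_ineq4)
    also have "\<dots> \<le> M * (norm (x + y))\<^sup>2 + M * (norm (x - y))\<^sup>2" by (intro add_mono M)
    also have "\<dots> = M * (2 * (norm x)\<^sup>2 + 2 * (norm y)\<^sup>2)"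
      by (simp only: distrib_left[symmetric] parallelogram_norm)
    finally show ?thesis by (simp add: algebra_simps)
  qed
  let ?x = "(1 / norm x) *\<^sub>R x" and ?y = "(1 / norm y) *\<^sub>R y"
  have "norm (B ?x ?y) \<le> M" using half[of ?x ?y] False by simp
  moreover have "norm (B ?x ?y) = norm (B x y) / (norm x * norm y)"
    by (simp add: bilinear_lmul[OF B] bilinear_rmul[OF B] mult.commute)
  ultimately show ?thesis using False by (simp add: field_simps)
qed

text \<open>A coordinate line through a point of the polydisc meets it in a full unit disc, so the
  disc estimates apply in each variable separately.\<close>

lemma polydisc_slice:
  fixes z :: "complex^'n" and i :: 'n
  assumes h: "mhol h polydisc" and z: "z \<in> polydisc"
  defines "q \<equiv> \<lambda>s. (z - axis i (z $ i)) + axis i s"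
  shows "(\<lambda>s. h (q s)) holomorphic_on ball 0 1" "deriv (\<lambda>s. h (q s)) (z $ i) = cpartial i h z"
    "\<And>s. norm s < 1 \<Longrightarrow> q s \<in> polydisc" "\<And>s k. q s $ k = (if k = i then s else z $ k)" "q (z $ i) = z"
proof -
  show q: "q s $ k = (if k = i then s else z $ k)" for s k by (simp add: q_def axis_def)
  show qp: "q s \<in> polydisc" if "norm s < 1" for s
    using z that by (auto simp: polydisc_def q)
  show qz: "q (z $ i) = z" by (simp add: q_def)
  have d: "((\<lambda>s. h (q s)) has_field_derivative cpartial i h (q s)) (at s)" if "norm s < 1" for s
    using mhol_axis_at[OF h, of "z - axis i (z $ i)" i s] qp[OF that] by (simp add: q_def)
  show "(\<lambda>s. h (q s)) holomorphic_on ball 0 1"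
    unfolding holomorphic_on_def field_differentiable_def
    by (rule ballI, rule exI, rule has_field_derivative_at_within[OF d], simp)
  show "deriv (\<lambda>s. h (q s)) (z $ i) = cpartial i h z"
    using DERIV_imp_deriv[OF d[of "z $ i"]] z by (simp add: qz polydisc_def)
qed

definition rho :: "complex^'n \<Rightarrow> 'n \<Rightarrow> real" where "rho z i = 1 - (norm (z $ i))\<^sup>2"

lemma rho_pos: "z \<in> polydisc \<Longrightarrow> 0 < rho z i"
  by (simp add: rho_def polydisc_def power_less_one_iff)

lemma bergman_norm_eq: "bergman_norm z v = sqrt 2 * norm (\<chi> i. v $ i / of_real (rho z i))"
  by (simp add: bergman_norm_def norm_vec_def L2_set_def rho_def norm_divide power_divide real_sqrt_mult
      del: of_real_diff)

section \<open>The weighted bilinear form and bounds for single Schwarzian coefficients\<close>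

locale schwarz_bounded = locally_biholomorphic f for f :: "complex^'n \<Rightarrow> complex^'n" +
  fixes \<alpha> :: real
  assumes card: "CARD('n) \<ge> 2" and \<alpha>: "\<alpha> \<ge> 0" and bound: "schwarzian_norm f \<le> ereal \<alpha>"
begin

text \<open>The Bergman norm is sqrt 2 times a Euclidean norm. A quadratic bound carries this factor
  once on the left and twice on the right, which leaves one sqrt 2 beside \<alpha>.\<close>

definition M where "M = sqrt 2 * \<alpha>"

lemma M_nonneg: "0 \<le> M" using \<alpha> by (simp add: M_def)

lemma schwarzian_op_scaleR: "schwarzian_op f z (c *\<^sub>R v) = (c\<^sup>2) *\<^sub>R schwarzian_op f z v"
  by (simp add: schwarzian_op_def vec_eq_iff scaleR_sum_right) (simp add: scaleR_conv_of_real power2_eq_square mult_ac)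

lemma bergman_norm_scaleR: "bergman_norm z (c *\<^sub>R v) = \<bar>c\<bar> * bergman_norm z v"
proof -
  have "(\<chi> i. (c *\<^sub>R v) $ i / of_real (rho z i)) = c *\<^sub>R (\<chi> i. v $ i / of_real (rho z i))"
    by (simp add: vec_eq_iff scaleR_conv_of_real)
  then show ?thesis by (simp add: bergman_norm_eq)
qed

lemma schwarzian_op_bound:
  assumes z: "z \<in> polydisc"
  shows "bergman_norm z (schwarzian_op f z v) \<le> \<alpha> * (bergman_norm z v)\<^sup>2"
proof (cases "bergman_norm z v = 0")
  case True
  then have "v $ i / of_real (rho z i) = 0" for i
    by (simp add: bergman_norm_eq vec_eq_iff)
  then have "v = 0" using rho_pos[OF z] by (simp add: vec_eq_iff less_imp_neq[THEN not_sym])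
  then show ?thesis by (simp add: schwarzian_op_def bergman_norm_def)
next
  case False
  have pos: "0 < bergman_norm z v" using False by (simp add: bergman_norm_eq)
  let ?u = "(1 / bergman_norm z v) *\<^sub>R v"
  have "bergman_norm z ?u = 1" using pos by (simp add: bergman_norm_scaleR)
  then have "ereal (bergman_norm z (schwarzian_op f z ?u)) \<le> schwarzian_norm_at f z"
    unfolding schwarzian_norm_at_def by (intro SUP_upper) simp
  also have "\<dots> \<le> schwarzian_norm f"
    unfolding schwarzian_norm_def by (intro SUP_upper z)
  also have "\<dots> \<le> ereal \<alpha>" by (rule bound)
  finally have "bergman_norm z (schwarzian_op f z ?u) \<le> \<alpha>" by simp
  then show ?thesis using pos
    by (simp add: schwarzian_op_scaleR bergman_norm_scaleR field_simps)
qed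

text \<open>The polarised Schwarzian operator in the coordinates x_i = v_i / \<open>rho z i\<close>,
  in which the Bergman norm is a multiple of the Euclidean norm.\<close>

definition T :: "complex^'n \<Rightarrow> complex^'n \<Rightarrow> complex^'n \<Rightarrow> complex^'n" where
  "T z x y = (\<chi> k. \<Sum>i\<in>UNIV. \<Sum>j\<in>UNIV. S k i j z * (rho z i * x $ i) * (rho z j * y $ j) / rho z k)"

lemma bilinear_T: "bilinear (T z)"
proof -
  have "T z (x + x') y = T z x y + T z x' y" "T z y (x + x') = T z y x + T z y x'" for x x' y
    by (simp_all add: T_def vec_eq_iff sum.distrib[symmetric] algebra_simps add_divide_distrib)
  moreover have "T z (c *\<^sub>R x) y = c *\<^sub>R T z x y" "T z y (c *\<^sub>R x) = c *\<^sub>R T z y x" for c x y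
    unfolding vec_eq_iff vector_scaleR_component T_def vec_lambda_beta
    by (simp_all add: scaleR_conv_of_real sum_distrib_left mult_ac)
  ultimately show ?thesis unfolding bilinear_def by (auto intro!: linearI)
qed

lemma T_sym:
  assumes "z \<in> polydisc"
  shows "T z x y = T z y x"
  unfolding T_def vec_eq_iff
  by (subst sum.swap) (simp add: S_sym[OF assms] mult_ac)

lemma T_bound:
  assumes z: "z \<in> polydisc"
  shows "norm (T z x y) \<le> M * norm x * norm y"
proof (rule symmetric_bilinear_bound[OF bilinear_T T_sym[OF z]])
  fix x :: "complex^'n"
  let ?v = "\<chi> i. rho z i * x $ i"
  have "(\<chi> i. ?v $ i / of_real (rho z i)) = x"
    using rho_pos[OF z] by (simp add: vec_eq_iff less_imp_neq[THEN not_sym])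
  then have 1: "bergman_norm z ?v = sqrt 2 * norm x" by (simp add: bergman_norm_eq)
  have "(\<chi> k. schwarzian_op f z ?v $ k / of_real (rho z k)) = T z x x"
    by (simp add: T_def schwarzian_op_def vec_eq_iff sum_divide_distrib mult_ac)
  then have 2: "bergman_norm z (schwarzian_op f z ?v) = sqrt 2 * norm (T z x x)"
    by (simp add: bergman_norm_eq)
  have "sqrt 2 * norm (T z x x) \<le> \<alpha> * (sqrt 2 * norm x)\<^sup>2"
    using schwarzian_op_bound[OF z, of ?v] unfolding 1 2 .
  also have "\<dots> = sqrt 2 * (M * (norm x)\<^sup>2)"
    by (simp add: M_def power_mult_distrib)
  finally show "norm (T z x x) \<le> M * (norm x)\<^sup>2" by simp
qed

lemma T_axis: "T z (axis i 1) (axis j 1) $ k = S k i j z * rho z i * rho z j / rho z k"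
proof -
  have "T z (axis i 1) (axis j 1) $ k = (\<Sum>i'\<in>UNIV. \<Sum>j'\<in>UNIV. if j' = j then
     (if i' = i then S k i' j' z * rho z i' * rho z j' / rho z k else 0) else 0)"
    unfolding T_def vec_lambda_beta by (intro sum.cong refl) (auto simp: axis_def)
  then show ?thesis by simp
qed

lemma S_bound:
  assumes z: "z \<in> polydisc"
  shows "norm (S k i j z) * rho z i * rho z j \<le> M * rho z k"
proof -
  note r = rho_pos[OF z]
  have "norm (T z (axis i 1) (axis j 1) $ k) \<le> M"
    using order_trans[OF Finite_Cartesian_Product.norm_nth_le T_bound[OF z, of "axis i 1" "axis j 1"]]
    by (simp add: norm_axis_complex)
  then show ?thesis
    using r[of i] r[of j] r[of k] unfolding T_axis
    by (simp add: norm_divide norm_mult abs_of_pos field_simps)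
qed

text \<open>As a function of z_k alone the coefficient is at most a constant times 1 - |z_k|^2,
  because \<open>rho z i\<close> and \<open>rho z j\<close> do not involve z_k. Hence it vanishes
  identically.\<close>

lemma S_zero:
  assumes z: "z \<in> polydisc" and k: "k \<noteq> i" "k \<noteq> j"
  shows "S k i j z = 0"
proof -
  let ?q = "\<lambda>s. (z - axis k (z $ k)) + axis k s"
  have "S k i j (?q (z $ k)) = 0"
  proof (rule holomorphic_zero_if_vanishing_bound[where K="M / (rho z i * rho z j)"
        and F="\<lambda>s. S k i j (?q s)" and a="z $ k"])
    show "(\<lambda>s. S k i j (?q s)) holomorphic_on ball 0 1" by (rule polydisc_slice(1)[OF mhol_S z])
    show "norm (z $ k) < 1" using z by (simp add: polydisc_def)
    fix s :: complex assume s: "norm s < 1"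
    have c: "rho (?q s) i = rho z i" "rho (?q s) j = rho z j" "rho (?q s) k = 1 - (norm s)\<^sup>2"
      using k by (simp_all add: rho_def axis_def)
    have "norm (S k i j (?q s)) * rho z i * rho z j \<le> M * (1 - (norm s)\<^sup>2)"
      using S_bound[OF polydisc_slice(3)[OF mhol_S z s], of k i j k] unfolding c .
    then show "norm (S k i j (?q s)) \<le> M / (rho z i * rho z j) * (1 - (norm s)\<^sup>2)"
      using rho_pos[OF z, of i] rho_pos[OF z, of j] by (simp add: pos_le_divide_eq mult.assoc)
  qed
  then show ?thesis by simp
qed

lemma S_diff_zero:
  assumes "z \<in> polydisc" "m \<noteq> i" "m \<noteq> j"
  shows "cpartial l (S m i j) z = 0"
proof -
  have "cpartial l (S m i j) z = cpartial l (\<lambda>_. 0) z"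
    by (rule cpartial_cong_open[OF open_polydisc assms(1) S_zero mhol_S]) (use assms in auto)
  then show ?thesis by simp
qed

lemma cpartial_S_sym:
  assumes "z \<in> polydisc"
  shows "cpartial l (S k i j) z = cpartial l (S k j i) z"
  by (rule cpartial_cong_open[OF open_polydisc assms S_sym mhol_S])

text \<open>For \<open>n = 2\<close> the vanishing trace couples the entries, which improves the trivial bound \<open>M\<close>;
  averaging the quadratic form over \<open>(1, 1)\<close> and \<open>(1, -1)\<close> gives \<open>5 \<bar>S\<bar>\<^sup>2 \<le> 4 M\<^sup>2\<close>.\<close>

definition m where "m = (if CARD('n) = 2 then 9 / 10 * M else M)"

lemma m_nonneg: "0 \<le> m" using M_nonneg by (simp add: m_def)

lemma S_diag_bound:
  assumes z: "z \<in> polydisc"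
  shows "norm (S i i j z) * rho z j \<le> m"
proof (cases "CARD('n) = 2")
  case False
  have "norm (S i i j z) * rho z j * rho z i \<le> M * rho z i"
    using S_bound[OF z, of i i j] by (simp add: mult_ac)
  then show ?thesis using False rho_pos[OF z, of i] by (simp add: m_def)
next
  case True
  obtain k where k: "k \<noteq> i" "UNIV = {i, k}"
  proof -
    from True obtain x y where "UNIV = {x, y}" "x \<noteq> (y::'n)" by (auto simp: card_2_iff)
    moreover from this have "i = x \<or> i = y" by blast
    ultimately show ?thesis using that[of x] that[of y] by (auto simp: insert_commute)
  qed
  define e where "e = (\<lambda>l. axis l (1::complex) :: complex^'n)"
  define A B C D where "A = S i i i z * rho z i" and "B = S i i k z * rho z k"
    and "C = S k k k z * rho z k" and "D = S k k i z * rho z i"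
  have two: "(\<Sum>l\<in>UNIV. g l) = g i + g k" for g :: "'n \<Rightarrow> complex"
    unfolding k(2) using k(1) by simp
  have "S i i i z = - S k k i z"
    using S_trace[OF z, of i] unfolding two S_sym[OF z, of k i k] by (simp add: add_eq_0_iff2)
  then have AD: "A = - D" by (simp add: A_def D_def)
  have "S k k k z = - S i i k z"
    using S_trace[OF z, of k] unfolding two S_sym[OF z, of i k i] by (simp add: add_eq_0_iff)
  then have CB: "C = - B" by (simp add: C_def B_def)
  have t: "T z (e i) (e i) $ i = A" "T z (e i) (e i) $ k = 0" "T z (e k) (e k) $ i = 0"
    "T z (e k) (e k) $ k = C" "T z (e i) (e k) $ i = B" "T z (e i) (e k) $ k = D"
    using k S_zero[OF z, of k i i] S_zero[OF z, of i k k] rho_pos[OF z, of i] rho_pos[OF z, of k]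
    by (simp_all add: e_def T_axis A_def B_def C_def D_def S_sym[OF z, of k i k])
  have exp: "T z (e i + c *\<^sub>R e k) (e i + c *\<^sub>R e k) = T z (e i) (e i) + (2 * c) *\<^sub>R T z (e i) (e k) + (c * c) *\<^sub>R T z (e k) (e k)" for c
    by (simp add: bilinear_ladd[OF bilinear_T] bilinear_radd[OF bilinear_T] bilinear_lmul[OF bilinear_T]
        bilinear_rmul[OF bilinear_T] T_sym[OF z, of "e k" "e i"] scaleR_2 scaleR_add_left algebra_simps flip: scaleR_scaleR)
  have ne: "(norm (e i + c *\<^sub>R e k))\<^sup>2 = 1 + c\<^sup>2" for c
    unfolding norm_vec_power2 k(2) using k(1) by (simp add: e_def axis_def)
  have bd: "(norm (A + (2 * c) *\<^sub>R B))\<^sup>2 + (norm ((2 * c) *\<^sub>R D + (c * c) *\<^sub>R C))\<^sup>2 \<le> (M * (1 + c\<^sup>2))\<^sup>2" for c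
  proof -
    let ?x = "e i + c *\<^sub>R e k"
    have "(norm (T z ?x ?x))\<^sup>2 \<le> (M * (1 + c\<^sup>2))\<^sup>2"
      using T_bound[OF z, of ?x ?x] ne[of c] by (intro power_mono) (auto simp: power2_eq_square mult.assoc)
    then show ?thesis
      unfolding exp norm_vec_power2 k(2) using k(1) by (simp add: t)
  qed
  \<comment> \<open>Adding the cases c = 1 and c = -1 cancels the cross terms; the trace relations
    |A| = |D| and |C| = |B| then leave only B and D.\<close>
  have "(norm (A + 2 *\<^sub>R B))\<^sup>2 + (norm (2 *\<^sub>R D + C))\<^sup>2 \<le> 4 * M\<^sup>2"
    using bd[of 1] by (simp add: power_mult_distrib)
  moreover have "(norm (A - 2 *\<^sub>R B))\<^sup>2 + (norm (C - 2 *\<^sub>R D))\<^sup>2 \<le> 4 * M\<^sup>2"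
    using bd[of "-1"] by (simp add: power_mult_distrib)
  moreover have "(norm (A + 2 *\<^sub>R B))\<^sup>2 + (norm (A - 2 *\<^sub>R B))\<^sup>2 = 2 * (norm A)\<^sup>2 + 8 * (norm B)\<^sup>2"
    using parallelogram_norm[of A "2 *\<^sub>R B"] by (simp add: power_mult_distrib)
  moreover have "(norm (C + 2 *\<^sub>R D))\<^sup>2 + (norm (C - 2 *\<^sub>R D))\<^sup>2 = 2 * (norm C)\<^sup>2 + 8 * (norm D)\<^sup>2"
    using parallelogram_norm[of C "2 *\<^sub>R D"] by (simp add: power_mult_distrib)
  ultimately have "5 * (norm B)\<^sup>2 + 5 * (norm D)\<^sup>2 \<le> 4 * M\<^sup>2"
    by (simp add: AD CB add.commute)
  \<comment> \<open>Since 4/5 < 81/100, the rational 9/10 replaces the square root of 4/5.\<close>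
  moreover have "(9/10 * M)\<^sup>2 = 81/100 * M\<^sup>2"
    by (simp add: power_mult_distrib power_divide)
  ultimately have "(norm B)\<^sup>2 \<le> (9/10 * M)\<^sup>2" "(norm D)\<^sup>2 \<le> (9/10 * M)\<^sup>2"
    using zero_le_power2[of "norm B"] zero_le_power2[of "norm D"] zero_le_power2[of M] by linarith+
  then have BD: "norm B \<le> 9/10 * M" "norm D \<le> 9/10 * M"
    using M_nonneg by (auto intro: power2_le_imp_le)
  have "j = i \<or> j = k" using k(2) by blast
  then show ?thesis
  proof
    assume j: "j = i"
    have "norm A \<le> 9/10 * M" using BD AD by simp
    then show ?thesis using rho_pos[OF z, of i] True by (simp add: A_def j m_def norm_mult)
  next
    assume j: "j = k"
    then show ?thesis using BD rho_pos[OF z, of k] True by (simp add: B_def m_def norm_mult)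
  qed
qed

text \<open>The bound \<open>m / rho z j\<close> for \<open>S i i j\<close> is constant in z_i when
  j differs from i, so the unweighted Schwarz-Pick estimate suffices.\<close>

lemma deriv_S_offdiag:
  assumes z: "z \<in> polydisc" and ij: "i \<noteq> j"
  shows "norm (cpartial i (S i i j) z) * (rho z i * rho z j) \<le> m"
proof -
  let ?q = "\<lambda>s. (z - axis i (z $ i)) + axis i s"
  have "norm (deriv (\<lambda>s. S i i j (?q s)) (z $ i)) * (1 - (norm (z $ i))\<^sup>2) \<le> m / rho z j"
  proof (rule Schwarz_Pick_deriv)
    show "(\<lambda>s. S i i j (?q s)) holomorphic_on ball 0 1" by (rule polydisc_slice(1)[OF mhol_S z])
    show "norm (z $ i) < 1" using z by (simp add: polydisc_def)
    fix s :: complex assume s: "norm s < 1"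
    have "rho (?q s) j = rho z j" using ij by (simp add: rho_def axis_def)
    then show "norm (S i i j (?q s)) \<le> m / rho z j"
      using S_diag_bound[OF polydisc_slice(3)[OF mhol_S z s], of i j i] rho_pos[OF z, of j]
      by (simp add: field_simps)
  qed
  then show ?thesis
    using rho_pos[OF z, of j] unfolding polydisc_slice(2)[OF mhol_S z] rho_def[symmetric]
    by (simp add: field_simps)
qed

text \<open>Here the bound for \<open>S i i i\<close> blows up in the very variable of
  differentiation, which calls for the hyperbolic weight and costs the factor 10/3.\<close>

lemma deriv_S_diag:
  assumes z: "z \<in> polydisc"
  shows "norm (cpartial i (S i i i) z) * (rho z i)\<^sup>2 \<le> 10 / 3 * m"
proof -
  let ?q = "\<lambda>s. (z - axis i (z $ i)) + axis i s"
  have "norm (deriv (\<lambda>s. S i i i (?q s)) (z $ i)) * (1 - (norm (z $ i))\<^sup>2)\<^sup>2 \<le> 10 / 3 * m"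
  proof (rule deriv_bound_hyperbolic_weight)
    show "(\<lambda>s. S i i i (?q s)) holomorphic_on ball 0 1" by (rule polydisc_slice(1)[OF mhol_S z])
    show "norm (z $ i) < 1" using z by (simp add: polydisc_def)
    fix s :: complex assume s: "norm s < 1"
    have "rho (?q s) i = 1 - (norm s)\<^sup>2" by (simp add: rho_def axis_def)
    then show "norm (S i i i (?q s)) * (1 - (norm s)\<^sup>2) \<le> m"
      using S_diag_bound[OF polydisc_slice(3)[OF mhol_S z s], of i i i] by simp
  qed
  then show ?thesis
    unfolding polydisc_slice(2)[OF mhol_S z] rho_def[symmetric] .
qed

end

lemma sum_if_singleton:
  fixes b :: real
  assumes "finite A" "i \<in> A"
  shows "(\<Sum>j\<in>A. if j = i then a else b) = a + (real (card A) - 1) * b"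
proof -
  have "(\<Sum>j\<in>A - {i}. if j = i then a else b) = real (card (A - {i})) * b"
    by (simp add: sum.neutral_const)
  moreover have "real (card (A - {i})) = real (card A) - 1"
    using assms card_gt_0_iff[of A] by (auto simp: card_Diff_singleton of_nat_diff)
  ultimately show ?thesis by (subst sum.remove[OF assms]) simp
qed

section \<open>Estimates of the Riccati system at points with all |z_i| equal\<close>

context schwarz_bounded
begin

text \<open>The numerator bounds a row of (n-1) \<open>Q\<close>: one diagonal divergence entry
  (10/3 \<open>m\<close>), n - 1 off-diagonal entries with two derivatives each (2
  \<open>m\<close>), and the part quadratic in \<open>S\<close>. The denominator is the factor from
  \<open>Q_eq\<close>.\<close>

definition R where "R = (10/3 * m + (real CARD('n) - 1) * (2 * m) + real CARD('n) * sqrt CARD('n) * M\<^sup>2) / (real CARD('n) - 1)"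

lemma R_nonneg: "0 \<le> R"
  using card m_nonneg by (simp add: R_def)

lemma Q_row_bound:
  assumes z: "\<And>i. norm (z $ i) = t" and t: "0 \<le> t" "t < 1" and \<zeta>: "\<And>i. norm (\<zeta> $ i) = 1"
  shows "norm (\<Sum>j\<in>UNIV. Q i j z * \<zeta> $ j) * (1 - t\<^sup>2)\<^sup>2 \<le> R"
proof -
  let ?r = "1 - t\<^sup>2" and ?n = "real CARD('n)"
  have r: "0 < ?r" using t by (simp add: power_less_one_iff)
  have zP: "z \<in> polydisc" using z t by (simp add: polydisc_def)
  have rho: "rho z k = ?r" for k by (simp add: rho_def z)
  define D where "D = (\<lambda>j. \<Sum>l\<in>UNIV. cpartial l (S l i j) z)"
  \<comment> \<open>By \<open>S_diff_zero\<close> only the terms l = i and l = j of the divergence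
    survive.\<close>
  have Db: "norm (D j) * ?r\<^sup>2 \<le> (if j = i then 10/3 * m else 2 * m)" for j
  proof (cases "j = i")
    case True
    have "D j = (\<Sum>l\<in>{i}. cpartial l (S l i j) z)"
      unfolding D_def True by (rule sum.mono_neutral_right) (auto intro: S_diff_zero[OF zP])
    then show ?thesis using deriv_S_diag[OF zP, of i] by (simp add: True rho)
  next
    case False
    have "D j = (\<Sum>l\<in>{i, j}. cpartial l (S l i j) z)"
      unfolding D_def by (rule sum.mono_neutral_right) (auto intro: S_diff_zero[OF zP])
    also have "\<dots> = cpartial i (S i i j) z + cpartial j (S j j i) z"
      using False by (simp add: cpartial_S_sym[OF zP, of j j i])
    finally have "norm (D j) \<le> norm (cpartial i (S i i j) z) + norm (cpartial j (S j j i) z)"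
      by (simp add: norm_triangle_ineq)
    then have "norm (D j) * ?r\<^sup>2 \<le> (norm (cpartial i (S i i j) z) + norm (cpartial j (S j j i) z)) * ?r\<^sup>2"
      by (rule mult_right_mono) simp
    also have "\<dots> \<le> m + m"
      using deriv_S_offdiag[OF zP, of i j] deriv_S_offdiag[OF zP, of j i] False
      unfolding rho by (simp add: distrib_right power2_eq_square)
    finally show ?thesis using False by simp
  qed
  have "norm (\<Sum>j\<in>UNIV. D j * \<zeta> $ j) * ?r\<^sup>2 \<le> (\<Sum>j\<in>UNIV. norm (D j)) * ?r\<^sup>2"
    by (intro mult_right_mono order_trans[OF norm_sum] sum_mono) (auto simp: norm_mult \<zeta>)
  also have "\<dots> \<le> (\<Sum>j\<in>UNIV. if j = i then 10/3 * m else 2 * m)"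
    unfolding sum_distrib_right by (intro sum_mono Db)
  also have "\<dots> = 10/3 * m + (?n - 1) * (2 * m)"
    by (rule sum_if_singleton) auto
  finally have first: "norm (\<Sum>j\<in>UNIV. D j * \<zeta> $ j) * ?r\<^sup>2 \<le> 10/3 * m + (?n - 1) * (2 * m)" .
  \<comment> \<open>The quadratic part is an iterated \<open>T\<close>: first on the axis vectors i
    and l, then on the result and \<zeta>. Each application costs \<open>M\<close>, the norm of
    \<zeta> is sqrt n, and the sum over l has n terms.\<close>
  define u where "u = (\<lambda>l. T z (axis i 1) (axis l 1))"
  have u: "u l $ k = S k i l z * ?r" for l k
    using r by (simp add: u_def T_axis rho)
  have Tu: "T z (u l) \<zeta> $ l = (\<Sum>k\<in>UNIV. \<Sum>j\<in>UNIV. S l k j z * S k i l z * \<zeta> $ j) * of_real (?r\<^sup>2)" for l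
    unfolding T_def vec_lambda_beta rho u sum_distrib_right
    using r by (intro sum.cong refl) (simp add: power2_eq_square mult_ac del: of_real_diff of_real_power)
  have second: "norm (\<Sum>j\<in>UNIV. (\<Sum>l\<in>UNIV. \<Sum>k\<in>UNIV. S k i l z * S l k j z) * \<zeta> $ j) * ?r\<^sup>2 \<le> ?n * sqrt ?n * M\<^sup>2"
  proof -
    have e: "(\<Sum>j\<in>UNIV. (\<Sum>l\<in>UNIV. \<Sum>k\<in>UNIV. S k i l z * S l k j z) * \<zeta> $ j) * of_real (?r\<^sup>2)
        = (\<Sum>l\<in>UNIV. T z (u l) \<zeta> $ l)"
    proof -
      have "(\<Sum>j\<in>UNIV. (\<Sum>l\<in>UNIV. \<Sum>k\<in>UNIV. S k i l z * S l k j z) * \<zeta> $ j)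
          = (\<Sum>j\<in>UNIV. \<Sum>l\<in>UNIV. \<Sum>k\<in>UNIV. S l k j z * S k i l z * \<zeta> $ j)"
        by (simp add: sum_distrib_right sum_distrib_left mult_ac)
      also have "\<dots> = (\<Sum>l\<in>UNIV. \<Sum>j\<in>UNIV. \<Sum>k\<in>UNIV. S l k j z * S k i l z * \<zeta> $ j)"
        by (rule sum.swap)
      also have "\<dots> = (\<Sum>l\<in>UNIV. \<Sum>k\<in>UNIV. \<Sum>j\<in>UNIV. S l k j z * S k i l z * \<zeta> $ j)"
        by (intro sum.cong refl sum.swap)
      finally show ?thesis by (simp add: Tu sum_distrib_right)
    qed
    have "norm (T z (u l) \<zeta> $ l) \<le> sqrt ?n * M\<^sup>2" for l
    proof -
      have "norm (T z (u l) \<zeta> $ l) \<le> M * norm (u l) * norm \<zeta>"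
        by (rule order_trans[OF Finite_Cartesian_Product.norm_nth_le T_bound[OF zP]])
      also have "\<dots> \<le> M * M * sqrt ?n"
        using T_bound[OF zP, of "axis i 1" "axis l 1"] M_nonneg
        unfolding u_def norm_vec_unimodular[OF \<zeta>]
        by (intro mult_right_mono mult_left_mono) (auto simp: norm_axis_complex)
      finally show ?thesis by (simp add: power2_eq_square mult_ac)
    qed
    then have "norm (\<Sum>l\<in>UNIV. T z (u l) \<zeta> $ l) \<le> (\<Sum>l\<in>(UNIV::'n set). sqrt ?n * M\<^sup>2)"
      by (intro order_trans[OF norm_sum] sum_mono)
    then have "norm ((\<Sum>j\<in>UNIV. (\<Sum>l\<in>UNIV. \<Sum>k\<in>UNIV. S k i l z * S l k j z) * \<zeta> $ j) * of_real (?r\<^sup>2)) \<le> ?n * sqrt ?n * M\<^sup>2"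
      unfolding e by simp
    then show ?thesis unfolding norm_mult norm_of_real by simp
  qed
  have n1: "of_nat CARD('n) - 1 = (of_real (?n - 1) :: complex)" by simp
  have "(of_nat CARD('n) - 1) * (\<Sum>j\<in>UNIV. Q i j z * \<zeta> $ j)
      = (\<Sum>j\<in>UNIV. (\<Sum>l\<in>UNIV. \<Sum>k\<in>UNIV. S k i l z * S l k j z) * \<zeta> $ j) - (\<Sum>j\<in>UNIV. D j * \<zeta> $ j)"
    unfolding sum_distrib_left mult.assoc[symmetric] Q_eq[OF zP] D_def
    by (simp add: left_diff_distrib sum_subtractf)
  then have "norm (of_real (?n - 1) * (\<Sum>j\<in>UNIV. Q i j z * \<zeta> $ j))
      \<le> norm (\<Sum>j\<in>UNIV. (\<Sum>l\<in>UNIV. \<Sum>k\<in>UNIV. S k i l z * S l k j z) * \<zeta> $ j) + norm (\<Sum>j\<in>UNIV. D j * \<zeta> $ j)"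
    unfolding n1 by (simp only: norm_triangle_ineq4)
  then have "(?n - 1) * norm (\<Sum>j\<in>UNIV. Q i j z * \<zeta> $ j)
      \<le> norm (\<Sum>j\<in>UNIV. (\<Sum>l\<in>UNIV. \<Sum>k\<in>UNIV. S k i l z * S l k j z) * \<zeta> $ j) + norm (\<Sum>j\<in>UNIV. D j * \<zeta> $ j)"
    using card unfolding norm_mult norm_of_real by simp
  then have "(?n - 1) * norm (\<Sum>j\<in>UNIV. Q i j z * \<zeta> $ j) * ?r\<^sup>2
      \<le> (norm (\<Sum>j\<in>UNIV. (\<Sum>l\<in>UNIV. \<Sum>k\<in>UNIV. S k i l z * S l k j z) * \<zeta> $ j) + norm (\<Sum>j\<in>UNIV. D j * \<zeta> $ j)) * ?r\<^sup>2"
    by (rule mult_right_mono) simp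
  also have "\<dots> \<le> ?n * sqrt ?n * M\<^sup>2 + (10/3 * m + (?n - 1) * (2 * m))"
    unfolding distrib_right[of "norm _"] by (rule add_mono[OF second first])
  finally show ?thesis
    using card by (simp add: R_def field_simps)
qed

text \<open>The contraction with \<open>w\<close> is the transpose of \<open>T z \<cdot> \<zeta>\<close>, so its norm is estimated by testing
  against the conjugate vector.\<close>

lemma S_contraction_bound:
  assumes z: "\<And>i. norm (z $ i) = t" and t: "0 \<le> t" "t < 1" and \<zeta>: "\<And>i. norm (\<zeta> $ i) = 1"
  shows "norm (\<chi> i. \<Sum>j\<in>UNIV. \<Sum>k\<in>UNIV. \<zeta> $ j * S k i j z * v $ k) * (1 - t\<^sup>2) \<le> M * sqrt (real CARD('n)) * norm v"
proof -
  let ?r = "1 - t\<^sup>2" and ?c = "\<chi> i. \<Sum>j\<in>UNIV. \<Sum>k\<in>UNIV. \<zeta> $ j * S k i j z * v $ k"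
  let ?y = "\<chi> i. cnj (?c $ i)"
  have r: "0 < ?r" using t by (simp add: power_less_one_iff)
  have zP: "z \<in> polydisc" using z t by (simp add: polydisc_def)
  have rho: "rho z k = ?r" for k by (simp add: rho_def z)
  have ny: "norm ?y = norm ?c" by (simp only: norm_vec_def vec_lambda_beta complex_mod_cnj)
  have Ty: "T z ?y \<zeta> $ k = (\<Sum>i\<in>UNIV. \<Sum>j\<in>UNIV. S k i j z * ?y $ i * \<zeta> $ j) * of_real ?r" for k
    unfolding T_def vec_lambda_beta rho sum_distrib_right
    using r by (intro sum.cong refl) (simp add: mult_ac del: of_real_diff of_real_power)
  have "of_real ((norm ?c)\<^sup>2 * ?r) = (\<Sum>i\<in>UNIV. ?y $ i * ?c $ i) * of_real ?r"
    unfolding norm_vec_power2 of_real_mult of_real_sum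
    by (simp add: complex_norm_square mult.commute del: of_real_power)
  also have "(\<Sum>i\<in>UNIV. ?y $ i * ?c $ i) = (\<Sum>i\<in>UNIV. \<Sum>j\<in>UNIV. \<Sum>k\<in>UNIV. S k i j z * ?y $ i * \<zeta> $ j * v $ k)"
    unfolding vec_lambda_beta[of "\<lambda>i. \<Sum>j\<in>UNIV. \<Sum>k\<in>UNIV. \<zeta> $ j * S k i j z * v $ k"] sum_distrib_left
    by (intro sum.cong refl) (simp add: mult_ac)
  also have "\<dots> = (\<Sum>i\<in>UNIV. \<Sum>k\<in>UNIV. \<Sum>j\<in>UNIV. S k i j z * ?y $ i * \<zeta> $ j * v $ k)"
    by (intro sum.cong refl sum.swap)
  also have "\<dots> = (\<Sum>k\<in>UNIV. \<Sum>i\<in>UNIV. \<Sum>j\<in>UNIV. S k i j z * ?y $ i * \<zeta> $ j * v $ k)"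
    by (rule sum.swap)
  also have "\<dots> * of_real ?r = (\<Sum>k\<in>UNIV. T z ?y \<zeta> $ k * v $ k)"
    unfolding Ty sum_distrib_right by (intro sum.cong refl) (simp add: mult_ac)
  finally have "norm (of_real ((norm ?c)\<^sup>2 * ?r) :: complex) = norm (\<Sum>k\<in>UNIV. T z ?y \<zeta> $ k * v $ k)"
    by (rule arg_cong)
  then have "(norm ?c)\<^sup>2 * ?r = norm (\<Sum>k\<in>UNIV. T z ?y \<zeta> $ k * v $ k)"
    using r unfolding norm_of_real by simp
  also have "\<dots> \<le> norm (T z ?y \<zeta>) * norm v" by (rule norm_cauchy_schwarz_complex)
  also have "\<dots> \<le> M * norm ?y * norm \<zeta> * norm v" by (intro mult_right_mono T_bound[OF zP]) auto
  also have "\<dots> = norm ?c * (M * sqrt (real CARD('n)) * norm v)"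
    unfolding ny norm_vec_unimodular[OF \<zeta>] by simp
  finally have *: "norm ?c * (norm ?c * ?r) \<le> norm ?c * (M * sqrt (real CARD('n)) * norm v)"
    by (simp add: power2_eq_square mult.assoc)
  show ?thesis
  proof (cases "norm ?c = 0")
    case True
    then show ?thesis using M_nonneg by simp
  next
    case False
    then have "0 < norm ?c" by simp
    from mult_le_cancel_left_pos[OF this] * show ?thesis by simp
  qed
qed

text \<open>The left side is the derivative of the vector w in direction \<zeta>. Contracting w_i
  w_j with \<zeta> costs |\<zeta>| = sqrt n in the quadratic term; scaling w by sqrt n later turns
  that coefficient into 1.\<close>

lemma radial_riccati_bound:
  assumes U: "U \<subseteq> polydisc" "\<And>z. z \<in> U \<Longrightarrow> L a z \<noteq> 0" and zU: "z \<in> U"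
    and z: "\<And>i. norm (z $ i) = t" and t: "0 \<le> t" "t < 1" and \<zeta>: "\<And>i. norm (\<zeta> $ i) = 1"
  shows "norm (\<chi> i. \<Sum>j\<in>UNIV. cpartial j (w a i) z * \<zeta> $ j) \<le>
    M * sqrt (real CARD('n)) * norm (\<chi> i. w a i z) / (1 - t\<^sup>2) + sqrt (real CARD('n)) * R / (1 - t\<^sup>2)\<^sup>2
    + sqrt (real CARD('n)) * (norm (\<chi> i. w a i z))\<^sup>2"
proof -
  let ?r = "1 - t\<^sup>2" and ?n = "real CARD('n)" and ?w = "\<chi> i. w a i z"
  have r: "0 < ?r" using t by (simp add: power_less_one_iff)
  let ?c = "\<chi> i. \<Sum>j\<in>UNIV. \<Sum>k\<in>UNIV. \<zeta> $ j * S k i j z * ?w $ k"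
  let ?q = "\<chi> i. \<Sum>j\<in>UNIV. Q i j z * \<zeta> $ j"
  let ?b = "\<Sum>j\<in>UNIV. ?w $ j * \<zeta> $ j"
  have ric: "cpartial j (w a i) z = (\<Sum>k\<in>UNIV. S k i j z * w a k z) + Q i j z - w a i z * w a j z" for i j
    by (rule riccati) (use U zU in auto)
  have "(\<chi> i. \<Sum>j\<in>UNIV. cpartial j (w a i) z * \<zeta> $ j) = ?c + ?q - (\<chi> i. ?b * ?w $ i)"
    by (simp add: ric vec_eq_iff sum.distrib sum_subtractf algebra_simps sum_distrib_left)
  then have "norm (\<chi> i. \<Sum>j\<in>UNIV. cpartial j (w a i) z * \<zeta> $ j) \<le> norm ?c + norm ?q + norm (\<chi> i. ?b * ?w $ i)"
    by (metis (no_types, lifting) add_right_mono norm_triangle_ineq norm_triangle_ineq4 order_trans)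
  moreover have "norm ?c \<le> M * sqrt ?n * norm ?w / ?r"
    using S_contraction_bound[OF z t \<zeta>, of ?w] r by (simp add: field_simps)
  moreover have "norm ?q \<le> sqrt ?n * (R / ?r\<^sup>2)"
    by (rule norm_vec_le_component) (use Q_row_bound[OF z t \<zeta>] r in \<open>simp add: field_simps\<close>)
  moreover have "norm (\<chi> i. ?b * ?w $ i) \<le> sqrt ?n * (norm ?w)\<^sup>2"
  proof -
    have "norm (\<chi> i. ?b * ?w $ i) = norm ?b * norm ?w"
      by (simp add: norm_vec_def norm_mult L2_set_right_distrib)
    also have "\<dots> \<le> norm ?w * norm \<zeta> * norm ?w"
      by (intro mult_right_mono norm_cauchy_schwarz_complex) auto
    finally show ?thesis by (simp add: norm_vec_unimodular[OF \<zeta>] power2_eq_square mult_ac)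
  qed
  ultimately show ?thesis by simp
qed

end

section \<open>Riccati comparison and nonvanishing\<close>

text \<open>Squared norms are compared from here on, because the norm itself need not be
  differentiable where \<open>y\<close> vanishes.\<close>

lemma has_real_derivative_inner_self:
  fixes y :: "real \<Rightarrow> 'a::real_inner"
  assumes "(y has_vector_derivative y') (at t)"
  shows "((\<lambda>t. y t \<bullet> y t) has_real_derivative 2 * (y t \<bullet> y')) (at t)"
proof -
  note d = assms[unfolded has_vector_derivative_def]
  have "(\<lambda>h. y t \<bullet> (h *\<^sub>R y') + (h *\<^sub>R y') \<bullet> y t) = (*) (2 * (y t \<bullet> y'))"
    by (rule ext) (simp add: inner_commute[of y'])
  with has_derivative_inner[OF d d] show ?thesis
    unfolding has_field_derivative_def by (simp only:)
qed

text \<open>The function \<open>(t + e) / (1 - t\<^sup>2)\<close> is a strict supersolution of the scalar Riccati equation.\<close>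

lemma riccati_comparison:
  fixes y :: "real \<Rightarrow> 'a::real_inner"
  assumes der: "\<And>t. 0 \<le> t \<Longrightarrow> t < b \<Longrightarrow> (y has_vector_derivative y' t) (at t)"
    and b: "b \<le> 1" and y0: "y 0 = 0"
    and bd: "\<And>t. 0 \<le> t \<Longrightarrow> t < b \<Longrightarrow> norm (y' t) \<le> A * norm (y t) / (1 - t\<^sup>2) + B / (1 - t\<^sup>2)\<^sup>2 + (norm (y t))\<^sup>2"
    and A: "0 \<le> A" and e: "0 < e" "A * (1 + e) + B + e\<^sup>2 < 1"
    and t: "0 \<le> t" "t < b"
  shows "norm (y t) < (t + e) / (1 - t\<^sup>2)"
proof -
  define \<psi> where "\<psi> = (\<lambda>t. (t + e) / (1 - t\<^sup>2))"
  define \<phi> where "\<phi> = (\<lambda>t. (\<psi> t)\<^sup>2 - y t \<bullet> y t)"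
  have pos: "0 < 1 - t\<^sup>2" if "0 \<le> t" "t < b" for t
    using that b by (simp add: power_less_one_iff)
  have d\<psi>: "(\<psi> has_real_derivative (1 + t\<^sup>2 + 2 * t * e) / (1 - t\<^sup>2)\<^sup>2) (at t)" if "0 \<le> t" "t < b" for t
    unfolding \<psi>_def using pos[OF that]
    by (auto intro!: derivative_eq_intros simp: power2_eq_square algebra_simps)
  have d\<phi>: "(\<phi> has_real_derivative 2 * \<psi> t * ((1 + t\<^sup>2 + 2 * t * e) / (1 - t\<^sup>2)\<^sup>2) - 2 * (y t \<bullet> y' t)) (at t)"
    if "0 \<le> t" "t < b" for t
    unfolding \<phi>_def
    using DERIV_diff[OF DERIV_power[OF d\<psi>[OF that], of 2] has_real_derivative_inner_self[OF der[OF that]]]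
    by (simp add: mult_ac)
  have c\<phi>: "continuous_on {0..s} \<phi>" if "s < b" for s
    by (rule DERIV_atLeastAtMost_imp_continuous_on) (use d\<phi> that in force)
  have \<phi>0: "0 < \<phi> 0" using e by (simp add: \<phi>_def \<psi>_def y0)
  have "0 < \<phi> t"
  proof (rule ccontr)
    assume "\<not> 0 < \<phi> t"
    define Z where "Z = {s \<in> {0..t}. \<phi> s = 0}"
    have zero: "\<exists>s'. 0 \<le> s' \<and> s' \<le> s \<and> \<phi> s' = 0" if "0 \<le> s" "s \<le> t" "\<phi> s \<le> 0" for s
      using IVT2'[of \<phi> s 0 0] that \<phi>0 c\<phi>[of s] t by auto
    have "Z \<noteq> {}" using zero[of t] t \<open>\<not> 0 < \<phi> t\<close> by (auto simp: Z_def)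
    moreover have "closed Z"
      unfolding Z_def by (rule continuous_closed_preimage_constant[OF c\<phi>[OF t(2)]]) simp
    moreover have bb: "bdd_below Z" by (rule bdd_belowI[of _ 0]) (auto simp: Z_def)
    ultimately have "Inf Z \<in> Z" by (metis closed_contains_Inf)
    \<comment> \<open>\<open>u\<close> is the first time at which |y| reaches \<psi>. There \<phi>
      will be shown to have positive derivative, although \<phi> is positive before \<open>u\<close>
      and zero at \<open>u\<close>.\<close>
    then obtain u where u: "u = Inf Z" "0 \<le> u" "u \<le> t" "\<phi> u = 0" by (auto simp: Z_def)
    have ub: "u < b" using u t by simp
    have u0: "0 < u" using u \<phi>0 by (cases "u = 0") auto
    have before: "0 < \<phi> s" if "0 \<le> s" "s < u" for s
    proof (rule ccontr)
      assume "\<not> 0 < \<phi> s"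
      then have "\<phi> s \<le> 0" "s \<le> t" using that(2) u(3) by linarith+
      from zero[OF that(1) this(2,1)]
      obtain s' where s': "0 \<le> s'" "s' \<le> s" "\<phi> s' = 0" by auto
      then have "s' \<in> Z" using that u by (auto simp: Z_def)
      then have "u \<le> s'" unfolding u(1) by (rule cInf_lower[OF _ bb])
      then show False using s' that by simp
    qed
    have \<psi>p: "0 < \<psi> u" using pos[OF u(2) ub] u0 e by (simp add: \<psi>_def)
    have "(norm (y u))\<^sup>2 = (\<psi> u)\<^sup>2" using u(4) by (simp add: \<phi>_def power2_norm_eq_inner)
    then have eq: "norm (y u) = \<psi> u" using \<psi>p by (simp add: power2_eq_iff_nonneg)
    have "A * (x / r) / r + B / r\<^sup>2 + (x / r)\<^sup>2 = (A * x + B + x\<^sup>2) / r\<^sup>2" if "r \<noteq> 0" for x r :: real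
      using that by (simp add: field_simps power2_eq_square)
    from this[of "1 - u\<^sup>2" "u + e"]
    have "norm (y' u) \<le> (A * (u + e) + B + (u + e)\<^sup>2) / (1 - u\<^sup>2)\<^sup>2"
      using bd[OF u(2) ub] pos[OF u(2) ub] unfolding eq \<psi>_def by (simp only: less_imp_neq[THEN not_sym] not_False_eq_True)
    also have "\<dots> < (1 + u\<^sup>2 + 2 * u * e) / (1 - u\<^sup>2)\<^sup>2"
    proof (rule divide_strict_right_mono)
      \<comment> \<open>The derivative of \<psi> has numerator 1 + u^2 + 2 u e = 1 + (u + e)^2 -
        e^2, so the squares cancel and exactly the hypothesis on \<open>e\<close> is left.\<close>
      have "A * (u + e) \<le> A * (1 + e)" using A ub b by (intro mult_left_mono) auto
      then show "A * (u + e) + B + (u + e)\<^sup>2 < 1 + u\<^sup>2 + 2 * u * e"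
        using e(2) by (simp add: power2_sum)
      show "0 < (1 - u\<^sup>2)\<^sup>2" using pos[OF u(2) ub] by simp
    qed
    finally have "norm (y u) * norm (y' u) < \<psi> u * ((1 + u\<^sup>2 + 2 * u * e) / (1 - u\<^sup>2)\<^sup>2)"
      unfolding eq using \<psi>p by (rule mult_strict_left_mono)
    moreover have "y u \<bullet> y' u \<le> norm (y u) * norm (y' u)" by (rule norm_cauchy_schwarz)
    ultimately have "0 < 2 * \<psi> u * ((1 + u\<^sup>2 + 2 * u * e) / (1 - u\<^sup>2)\<^sup>2) - 2 * (y u \<bullet> y' u)"
      by linarith
    from DERIV_pos_inc_left[OF d\<phi>[OF u(2) ub] this]
    obtain d where d: "d > 0" "\<And>h. 0 < h \<Longrightarrow> h < d \<Longrightarrow> \<phi> (u - h) < \<phi> u" by blast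
    \<comment> \<open>The minimum with \<open>u\<close> keeps the earlier point nonnegative.\<close>
    have "\<phi> (u - min (d/2) u) < \<phi> u" using d(1) u0 by (intro d(2)) auto
    moreover have "0 < \<phi> (u - min (d/2) u)" using d(1) u0 by (intro before) auto
    ultimately show False using u(4) by simp
  qed
  then have "(norm (y t))\<^sup>2 < (\<psi> t)\<^sup>2" by (simp add: \<phi>_def power2_norm_eq_inner)
  moreover have "0 \<le> \<psi> t" using pos[OF t] t e by (simp add: \<psi>_def)
  ultimately have "norm (y t) < \<psi> t" by (rule power_less_imp_less_base)
  then show ?thesis by (simp only: \<psi>_def)
qed

text \<open>|c|^2 exp(2 C t) is nondecreasing. No logarithm of \<open>c\<close> is taken, so nothing
  about its zeros has to be known beforehand.\<close>

lemma gronwall_lower: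
  fixes c :: "real \<Rightarrow> 'a::real_inner"
  assumes der: "\<And>t. 0 \<le> t \<Longrightarrow> t < b \<Longrightarrow> (c has_vector_derivative c' t) (at t)"
    and bd: "\<And>t. 0 \<le> t \<Longrightarrow> t < b \<Longrightarrow> norm (c' t) \<le> C * norm (c t)"
    and t: "0 \<le> t" "t < b"
  shows "norm (c 0) * exp (- C * t) \<le> norm (c t)"
proof -
  let ?g = "\<lambda>t. (c t \<bullet> c t) * exp (2 * C * t)"
  have "?g 0 \<le> ?g t"
  proof (rule DERIV_nonneg_imp_nondecreasing[OF t(1)])
    fix s assume s: "0 \<le> s" "s \<le> t"
    then have sb: "s < b" using t by simp
    have "((\<lambda>t. exp (2 * C * t)) has_real_derivative exp (2 * C * s) * (2 * C)) (at s)"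
      by (auto intro!: derivative_eq_intros)
    from DERIV_mult[OF has_real_derivative_inner_self[OF der[OF s(1) sb]] this]
    have "(?g has_real_derivative (2 * (c s \<bullet> c' s) + 2 * C * (c s \<bullet> c s)) * exp (2 * C * s)) (at s)"
      by (simp add: algebra_simps)
    moreover have "\<bar>c s \<bullet> c' s\<bar> \<le> C * (c s \<bullet> c s)"
    proof -
      have "\<bar>c s \<bullet> c' s\<bar> \<le> norm (c s) * norm (c' s)" by (rule Cauchy_Schwarz_ineq2)
      also have "\<dots> \<le> norm (c s) * (C * norm (c s))" by (intro mult_left_mono bd s sb) auto
      finally show ?thesis by (simp add: dot_square_norm power2_eq_square mult_ac)
    qed
    ultimately show "\<exists>d. (?g has_real_derivative d) (at s) \<and> 0 \<le> d"
      by (intro exI[of _ "(2 * (c s \<bullet> c' s) + 2 * C * (c s \<bullet> c s)) * exp (2 * C * s)"] conjI) auto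
  qed
  then have "(norm (c 0))\<^sup>2 \<le> (norm (c t) * exp (C * t))\<^sup>2"
    by (simp add: dot_square_norm power_mult_distrib exp_double[symmetric] mult.assoc)
  then have "norm (c 0) \<le> norm (c t) * exp (C * t)"
    by (rule power2_le_imp_le) simp
  then show ?thesis by (simp add: exp_minus field_simps)
qed

section \<open>Derivatives along rays and of vector-valued functions\<close>

lemma mhol_ray:
  assumes "mhol h U" "t *\<^sub>R \<zeta> \<in> U"
  shows "((\<lambda>t. h (t *\<^sub>R \<zeta>)) has_vector_derivative (\<Sum>j\<in>UNIV. cpartial j h (t *\<^sub>R \<zeta>) * \<zeta> $ j)) (at t)"
proof -
  have "((\<lambda>t. t *\<^sub>R \<zeta>) has_derivative (\<lambda>x. x *\<^sub>R \<zeta>)) (at t)"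
    by (auto intro!: derivative_eq_intros)
  from has_derivative_compose[OF this mholD[OF assms]]
  have "((\<lambda>t. h (t *\<^sub>R \<zeta>)) has_derivative (\<lambda>x. \<Sum>j\<in>UNIV. cpartial j h (t *\<^sub>R \<zeta>) * (x *\<^sub>R \<zeta>) $ j)) (at t)" .
  then show ?thesis
    by (simp add: has_vector_derivative_def scaleR_sum_right)
qed

lemma vec_lambda_eq_sum_axis: "(\<chi> i. g i) = (\<Sum>i\<in>UNIV. axis i (g i :: complex))"
proof -
  have "(\<Sum>i\<in>UNIV. axis i (g i)) $ j = (\<Sum>i\<in>UNIV. if j = i then g i else 0)" for j
    unfolding sum_component by (intro sum.cong refl) (simp add: axis_def)
  then show ?thesis by (simp add: vec_eq_iff)
qed

lemma has_vector_derivative_vec_lambda: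
  assumes "\<And>i. (g i has_vector_derivative (g' i :: complex)) F"
  shows "((\<lambda>t. \<chi> i. g i t) has_vector_derivative (\<chi> i. g' i)) F"
  unfolding vec_lambda_eq_sum_axis
  by (intro has_vector_derivative_sum bounded_linear.has_vector_derivative[OF bounded_linear_axis] assms)

lemma cn_holomorphic_onI:
  fixes g :: "complex^'n \<Rightarrow> complex^'m"
  assumes "\<And>k. mhol (\<lambda>z. g z $ k) U"
  shows "cn_holomorphic_on g U"
  unfolding cn_holomorphic_on_def
proof
  fix z assume z: "z \<in> U"
  have "((\<lambda>z. \<chi> k. g z $ k) has_derivative
      (\<lambda>v. \<chi> k. \<Sum>i\<in>UNIV. cpartial i (\<lambda>z. g z $ k) z * v $ i)) (at z)"
    unfolding vec_lambda_eq_sum_axis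
    by (intro has_derivative_sum bounded_linear.has_derivative[OF bounded_linear_axis] mholD[OF assms z])
  moreover have "(\<lambda>z. \<chi> k. g z $ k) = g" by simp
  moreover have "(\<lambda>v. \<chi> k. \<Sum>i\<in>UNIV. cpartial i (\<lambda>z. g z $ k) z * v $ i)
      = (\<lambda>v. (\<chi> k i. cpartial i (\<lambda>z. g z $ k) z) *v v)"
    by (simp add: matrix_vector_mult_def)
  ultimately have "(g has_derivative (\<lambda>v. (\<chi> k i. cpartial i (\<lambda>z. g z $ k) z) *v v)) (at z)"
    by (simp only:)
  then show "\<exists>A. (g has_derivative (*v) A) (at z)" by blast
qed

lemma closed_polydisc_less:
  fixes z :: "complex^'n"
  assumes "\<And>i. norm (z $ i) < b"
  obtains r where "0 \<le> r" "r < b" "\<And>i. norm (z $ i) \<le> r"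
proof
  let ?S = "range (\<lambda>i. norm (z $ i))"
  show "Max ?S < b" using assms by (subst Max_less_iff) auto
  show le: "norm (z $ i) \<le> Max ?S" for i by (rule Max_ge) auto
  show "0 \<le> Max ?S" using order_trans[OF norm_ge_zero le[of undefined]] .
qed

section \<open>The numerical condition and the bound for the logarithmic gradient\<close>

context schwarz_bounded
begin

lemma numeric_condition:
  assumes h: "real CARD('n) * sqrt (real CARD('n)) * \<alpha> \<le> 1 / 6.1"
  shows "M * sqrt (real CARD('n)) + real CARD('n) * R < 1"
proof -
  let ?n = "real CARD('n)"
  have s2: "sqrt 2 \<le> 1.4145"
    by (rule real_le_lsqrt) (simp_all add: power2_eq_square)
  show ?thesis
  proof (cases "CARD('n) = 2")
    case True
    \<comment> \<open>For n = 2 the hypothesis reads 2 \<open>M\<close> <= 1/6.1.\<close>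
    have M1: "M \<le> 0.082"
      using h unfolding True M_def by (simp add: mult.commute[of \<alpha>])
    have sq: "sqrt 2 * M\<^sup>2 \<le> 1.4145 * (0.082)\<^sup>2"
      using M1 M_nonneg s2 by (intro mult_mono power_mono) auto
    have "M * sqrt 2 \<le> 0.082 * 1.4145"
      using M1 M_nonneg s2 by (intro mult_mono) auto
    \<comment> \<open>4.8 is 9/10 times 10/3 + 2; without the gain 9/10 the final sum would not stay
      below 1.\<close>
    moreover have "2 * R = 2 * (4.8 * M + 2 * (sqrt 2 * M\<^sup>2))"
      unfolding R_def m_def True by simp
    ultimately show ?thesis
      using M1 sq unfolding True by (simp add: power2_eq_square)
  next
    case False
    then have n3: "3 \<le> ?n" using card by simp
    have sn: "1.732 \<le> sqrt ?n"
      by (rule real_le_rsqrt) (use n3 in \<open>simp add: power2_eq_square\<close>)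
    have x: "?n * sqrt ?n * M \<le> 0.2319"
    proof -
      have "?n * sqrt ?n * M = sqrt 2 * (?n * sqrt ?n * \<alpha>)" by (simp add: M_def)
      also have "\<dots> \<le> 1.4145 * (1 / 6.1)" using s2 h \<alpha> by (intro mult_mono) auto
      finally show ?thesis by simp
    qed
    have "1.732 * (?n * M) \<le> sqrt ?n * (?n * M)"
      using sn M_nonneg by (intro mult_right_mono) auto
    then have y: "?n * M \<le> 0.1339" using x by (simp add: mult_ac)
    have nm: "0 \<le> ?n * M" using M_nonneg by simp
    have "3 * (sqrt ?n * M) \<le> ?n * (sqrt ?n * M)"
      using n3 M_nonneg by (intro mult_right_mono) auto
    then have a: "M * sqrt ?n \<le> 0.0773" using x by (simp add: mult_ac)
    have "(?n * M) * (?n * sqrt ?n * M) \<le> 0.1339 * 0.2319"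
      using x y M_nonneg by (intro mult_mono) auto
    moreover have "(?n - 1) * (?n * M) \<le> (?n - 1) * 0.1339"
      using y n3 by (intro mult_left_mono) auto
    moreover have "?n * (10/3 * M + (?n - 1) * (2 * M) + ?n * sqrt ?n * M\<^sup>2)
      = 10/3 * (?n * M) + 2 * ((?n - 1) * (?n * M)) + (?n * M) * (?n * sqrt ?n * M)"
      by (simp add: algebra_simps power2_eq_square)
    \<comment> \<open>The terms free of n - 1 add up to less than 0.478, hence to at most 0.239 (n -
      1) because n - 1 >= 2; the remaining term is at most 0.268 (n - 1).\<close>
    ultimately have "?n * (10/3 * M + (?n - 1) * (2 * M) + ?n * sqrt ?n * M\<^sup>2) \<le> 0.51 * (?n - 1)"
      using y n3 by (simp add: algebra_simps)
    then have "?n * R \<le> 0.51"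
      unfolding R_def m_def using False n3 by (simp add: field_simps)
    then show ?thesis using a by simp
  qed
qed

text \<open>Riccati comparison for sqrt n w along the ray, starting from 0 because w vanishes at the
  origin.\<close>

lemma w_bound_on_torus:
  assumes U: "U = {z. \<forall>i. norm (z $ i) < b}" "b \<le> 1" "\<And>z. z \<in> U \<Longrightarrow> L a z \<noteq> 0"
    and w0: "\<And>i. w a i 0 = 0" and \<zeta>: "\<And>i. norm (\<zeta> $ i) = 1" and t: "0 \<le> t" "t < b"
    and e: "0 < e" "M * sqrt (real CARD('n)) * (1 + e) + real CARD('n) * R + e\<^sup>2 < 1"
  shows "sqrt (real CARD('n)) * norm (\<chi> i. w a i (t *\<^sub>R \<zeta>)) < (t + e) / (1 - t\<^sup>2)"
proof -
  let ?n = "real CARD('n)"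
  have UP: "U \<subseteq> polydisc" using U(1,2) by (auto simp: polydisc_def intro: less_le_trans)
  define W where "W = (\<lambda>t. sqrt ?n *\<^sub>R (\<chi> i. w a i (t *\<^sub>R \<zeta>)))"
  define W' where "W' = (\<lambda>t. sqrt ?n *\<^sub>R (\<chi> i. \<Sum>j\<in>UNIV. cpartial j (w a i) (t *\<^sub>R \<zeta>) * \<zeta> $ j))"
  have tU: "t *\<^sub>R \<zeta> \<in> U" if "0 \<le> t" "t < b" for t using that by (auto simp: U(1) \<zeta>)
  have "norm (W t) < (t + e) / (1 - t\<^sup>2)"
  proof (rule riccati_comparison[of b W W', OF _ U(2) _ _ _ e t])
    show "W 0 = 0" by (simp add: W_def w0 vec_eq_iff)
    show "0 \<le> M * sqrt ?n" using M_nonneg by simp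
    fix t :: real assume t: "0 \<le> t" "t < b"
    show "(W has_vector_derivative W' t) (at t)"
      unfolding W_def W'_def
      by (intro bounded_linear.has_vector_derivative[OF bounded_linear_scaleR_right]
          has_vector_derivative_vec_lambda mhol_ray[OF mhol_w[OF UP U(3)] tU[OF t]])
    have "norm (W' t) \<le> sqrt ?n * (M * sqrt ?n * norm (\<chi> i. w a i (t *\<^sub>R \<zeta>)) / (1 - t\<^sup>2)
        + sqrt ?n * R / (1 - t\<^sup>2)\<^sup>2 + sqrt ?n * (norm (\<chi> i. w a i (t *\<^sub>R \<zeta>)))\<^sup>2)"
      unfolding W'_def norm_scaleR
      using radial_riccati_bound[OF UP U(3) tU[OF t], of t \<zeta>] t U(2) \<zeta>
      by (simp add: mult_left_mono)
    also have "\<dots> = M * sqrt ?n * norm (W t) / (1 - t\<^sup>2) + ?n * R / (1 - t\<^sup>2)\<^sup>2 + (norm (W t))\<^sup>2"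
      by (simp add: W_def distrib_left power_mult_distrib mult.assoc[symmetric])
    finally show "norm (W' t) \<le> M * sqrt ?n * norm (W t) / (1 - t\<^sup>2) + ?n * R / (1 - t\<^sup>2)\<^sup>2 + (norm (W t))\<^sup>2" .
  qed
  then show ?thesis by (simp add: W_def)
qed

end

lemma quadratic_slack:
  fixes A B :: real
  assumes A: "0 \<le> A" "0 \<le> B" and AB: "A + B < 1"
  obtains e where "0 < e" "A * (1 + e) + B + e\<^sup>2 < 1"
proof -
  \<comment> \<open>This choice makes A e + e equal to half of the slack 1 - A - B, and e^2 <=
    e.\<close>
  define e where "e = (1 - A - B) / (2 * (A + 1))"
  have e0: "0 < e" using assms by (simp add: e_def)
  have e1: "e \<le> 1" using assms by (simp add: e_def field_simps)
  have eA: "e * (A + 1) = (1 - A - B) / 2" using A by (simp add: e_def field_simps)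
  have "e\<^sup>2 \<le> e" using e0 e1 by (simp add: power2_eq_square mult_left_le)
  moreover have "A * (1 + e) + e = A + e * (A + 1)" by (simp add: algebra_simps)
  ultimately have "A * (1 + e) + B + e\<^sup>2 < 1" using AB unfolding eA by argo
  with e0 show ?thesis by (rule that)
qed

section \<open>Excluding a zero of minimal sup norm\<close>

context schwarz_bounded
begin

lemma L_nonzero:
  assumes num: "M * sqrt (real CARD('n)) + real CARD('n) * R < 1"
    and w0: "\<And>i. w a i 0 = 0" and L0: "L a 0 = 1" and z: "z \<in> polydisc"
  shows "L a z \<noteq> 0"
proof
  let ?n = "real CARD('n)"
  assume Lz: "L a z = 0"
  obtain s where s: "0 \<le> s" "s < 1" "\<And>i. norm (z $ i) \<le> s"
    by (rule closed_polydisc_less[of z 1]) (use z in \<open>auto simp: polydisc_def\<close>)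
  \<comment> \<open>Pairs of a radius and a point of the closed polydisc of that radius. Minimising
    the first component over the compact set of zeros yields a zero of least sup norm.\<close>
  define K where "K = {x :: real \<times> (complex^'n). 0 \<le> fst x \<and> fst x \<le> s \<and> (\<forall>i. norm (snd x $ i) \<le> fst x)}"
  have Kc: "closed K"
    unfolding K_def by (intro closed_Collect_conj closed_Collect_all closed_Collect_le continuous_intros)
  have KP: "snd x \<in> polydisc" if "x \<in> K" for x
  proof -
    have "norm (snd x $ i) < 1" for i
      using that s(2) by (auto simp: K_def intro: le_less_trans)
    then show ?thesis by (simp add: polydisc_def)
  qed
  have "K \<subseteq> {0..s} \<times> cball 0 (sqrt ?n * s)"
  proof
    fix x assume x: "x \<in> K"
    have "norm (snd x) \<le> sqrt ?n * s"
      by (rule norm_vec_le_component) (use x in \<open>auto simp: K_def intro: order_trans\<close>)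
    then show "x \<in> {0..s} \<times> cball 0 (sqrt ?n * s)" using x by (cases x) (auto simp: K_def)
  qed
  then have Kb: "bounded K"
    by (rule bounded_subset[rotated]) (intro bounded_Times bounded_cball bounded_closed_interval)
  define Z where "Z = {x \<in> K. L a (snd x) = 0}"
  have "continuous_on K (\<lambda>x. L a (snd x))"
    by (rule continuous_on_compose2[OF mhol_continuous[OF mhol_L]]) (use KP in \<open>auto intro!: continuous_intros\<close>)
  then have "closed Z" unfolding Z_def by (rule continuous_closed_preimage_constant[OF _ Kc])
  moreover have "bounded Z" using Kb by (rule bounded_subset) (auto simp: Z_def)
  ultimately have "compact Z" by (simp add: compact_eq_bounded_closed)
  moreover have "(s, z) \<in> Z" using s Lz by (auto simp: Z_def K_def)
  ultimately have "\<exists>x\<in>Z. \<forall>y\<in>Z. fst x \<le> fst y"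
    by (intro continuous_attains_inf continuous_on_fst continuous_on_id) auto
  then obtain x where x: "x \<in> Z" "\<And>y. y \<in> Z \<Longrightarrow> fst x \<le> fst y" by blast
  define b where "b = fst x"
  define z1 where "z1 = snd x"
  have b: "0 \<le> b" "b \<le> s" and z1: "\<And>i. norm (z1 $ i) \<le> b" and Lz1: "L a z1 = 0"
    using x(1) by (auto simp: Z_def K_def b_def z1_def)
  have b1: "b < 1" using b s by simp
  define U where "U = {z :: complex^'n. \<forall>i. norm (z $ i) < b}"
  have UP: "U \<subseteq> polydisc" using b1 by (auto simp: U_def polydisc_def intro: less_trans)
  have LU: "L a y \<noteq> 0" if yU: "y \<in> U" for y
  proof
    assume Ly: "L a y = 0"
    obtain r where r: "0 \<le> r" "r < b" "\<And>i. norm (y $ i) \<le> r"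
      by (rule closed_polydisc_less[of y b]) (use yU in \<open>auto simp: U_def\<close>)
    have "(r, y) \<in> Z" using r b Ly by (auto simp: Z_def K_def)
    from x(2)[OF this] r show False by (simp add: b_def)
  qed
  obtain e where e: "0 < e" "M * sqrt ?n * (1 + e) + ?n * R + e\<^sup>2 < 1"
    by (rule quadratic_slack[OF _ _ num]) (use M_nonneg R_nonneg in simp_all)
  \<comment> \<open>The bound on \<open>w\<close> controls the logarithmic derivative of
    \<open>L\<close> only up to \<open>p\<close>. Here mere boundedness of \<open>p\<close> is
    enough, and compactness supplies it since b < 1.\<close>
  have "continuous_on {z. \<forall>i. norm (z $ i) \<le> b} (\<lambda>z. \<Sum>j\<in>UNIV. norm (p j z))"
    using b1 by (intro continuous_intros continuous_on_subset[OF mhol_continuous[OF mhol_p]])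
      (auto simp: polydisc_def intro: le_less_trans)
  moreover have "compact {z :: complex^'n. \<forall>i. norm (z $ i) \<le> b}"
    unfolding compact_eq_bounded_closed
  proof
    show "closed {z :: complex^'n. \<forall>i. norm (z $ i) \<le> b}"
      by (intro closed_Collect_all closed_Collect_le continuous_intros)
    show "bounded {z :: complex^'n. \<forall>i. norm (z $ i) \<le> b}"
      by (rule boundedI[of _ "sqrt ?n * b"]) (auto intro: norm_vec_le_component)
  qed
  ultimately have "bounded ((\<lambda>z. \<Sum>j\<in>UNIV. norm (p j z)) ` {z. \<forall>i. norm (z $ i) \<le> b})"
    by (intro compact_imp_bounded compact_continuous_image)
  then obtain P where P: "0 < P" "\<And>z. (\<And>i. norm (z $ i) \<le> b) \<Longrightarrow> (\<Sum>j\<in>UNIV. norm (p j z)) \<le> P"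
    unfolding bounded_pos by (auto simp: sum_nonneg)
  \<comment> \<open>Bounds the logarithmic derivative of \<open>L\<close> along all rays, uniformly
    in \<zeta> and in t < b.\<close>
  define C where "C = (1 + e) / (1 - b\<^sup>2) + P"
  have b2: "0 < 1 - b\<^sup>2" using b b1 by (simp add: power_less_one_iff)
  have C: "0 \<le> C" using e P b2 by (simp add: C_def)
  have ray: "exp (- C) \<le> norm (L a (t *\<^sub>R \<zeta>))" if \<zeta>: "\<And>i. norm (\<zeta> $ i) = 1" and t: "0 \<le> t" "t < b" for \<zeta> t
  proof -
    have tU: "t *\<^sub>R \<zeta> \<in> U" if "0 \<le> t" "t < b" for t using that by (auto simp: U_def \<zeta>)
    have "norm (L a (0 *\<^sub>R \<zeta>)) * exp (- C * t) \<le> norm (L a (t *\<^sub>R \<zeta>))"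
    proof (rule gronwall_lower[where b=b and c'="\<lambda>t. \<Sum>j\<in>UNIV. cpartial j (L a) (t *\<^sub>R \<zeta>) * \<zeta> $ j", OF _ _ t])
      fix t :: real assume t: "0 \<le> t" "t < b"
      let ?y = "t *\<^sub>R \<zeta>"
      show "((\<lambda>t. L a (t *\<^sub>R \<zeta>)) has_vector_derivative (\<Sum>j\<in>UNIV. cpartial j (L a) ?y * \<zeta> $ j)) (at t)"
        by (rule mhol_ray[OF mhol_L]) (use tU[OF t] UP in auto)
      have cp: "cpartial j (L a) ?y = L a ?y * (w a j ?y - p j ?y)" for j
        using LU[OF tU[OF t]] by (simp add: w_def)
      have "(\<Sum>j\<in>UNIV. cpartial j (L a) ?y * \<zeta> $ j)
          = L a ?y * ((\<Sum>j\<in>UNIV. (\<chi> i. w a i ?y) $ j * \<zeta> $ j) - (\<Sum>j\<in>UNIV. p j ?y * \<zeta> $ j))"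
        unfolding cp by (simp add: sum_distrib_left sum_subtractf[symmetric] algebra_simps)
      also have "norm \<dots> \<le> norm (L a ?y) * C"
        unfolding norm_mult
      proof (rule mult_left_mono)
        have "norm (\<Sum>j\<in>UNIV. (\<chi> i. w a i ?y) $ j * \<zeta> $ j) \<le> norm (\<chi> i. w a i ?y) * norm \<zeta>"
          by (rule norm_cauchy_schwarz_complex)
        also have "\<dots> = sqrt ?n * norm (\<chi> i. w a i ?y)" by (simp add: norm_vec_unimodular[OF \<zeta>])
        also have "\<dots> \<le> (t + e) / (1 - t\<^sup>2)"
          using w_bound_on_torus[OF U_def _ LU w0 \<zeta> t e] b1 by simp
        also have "\<dots> \<le> (1 + e) / (1 - b\<^sup>2)"
          using t b1 b2 e(1) by (intro frac_le) (auto intro: power_mono)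
        finally have 1: "norm (\<Sum>j\<in>UNIV. (\<chi> i. w a i ?y) $ j * \<zeta> $ j) \<le> (1 + e) / (1 - b\<^sup>2)" .
        have "norm (\<Sum>j\<in>UNIV. p j ?y * \<zeta> $ j) \<le> (\<Sum>j\<in>UNIV. norm (p j ?y))"
          by (intro order_trans[OF norm_sum] sum_mono) (simp add: norm_mult \<zeta>)
        also have "\<dots> \<le> P" using t by (intro P) (simp add: \<zeta>)
        finally show "norm ((\<Sum>j\<in>UNIV. (\<chi> i. w a i ?y) $ j * \<zeta> $ j) - (\<Sum>j\<in>UNIV. p j ?y * \<zeta> $ j)) \<le> C"
          unfolding C_def using 1 by (intro order_trans[OF norm_triangle_ineq4] add_mono)
      qed simp
      finally show "norm (\<Sum>j\<in>UNIV. cpartial j (L a) ?y * \<zeta> $ j) \<le> C * norm (L a ?y)"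
        by (simp add: mult.commute)
    qed
    moreover have "exp (- C) \<le> exp (- C * t)"
    proof -
      have "C * t \<le> C * 1" using C t b1 by (intro mult_left_mono) auto
      then show ?thesis by simp
    qed
    moreover have "norm (L a (0 *\<^sub>R \<zeta>)) = 1" by (simp add: L0)
    ultimately show ?thesis by (metis mult_1 order_trans)
  qed
  \<comment> \<open>A point of \<open>U\<close> need not lie on an admissible ray, but some closed
    polydisc of radius r < b contains it, and the torus of radius r consists of points on admissible
    rays.\<close>
  have lower: "exp (- C) \<le> norm (L a y)" if y: "y \<in> U" for y
  proof -
    obtain r where r: "0 \<le> r" "r < b" "\<And>i. norm (y $ i) \<le> r"
      by (rule closed_polydisc_less[of y b]) (use y in \<open>auto simp: U_def\<close>)
    have "norm (inverse (L a y)) \<le> exp C"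
    proof (rule polydisc_maximum_modulus[OF mhol_inverse[OF mhol_subset[OF mhol_L UP] LU] _ _ r(3)])
      show "{z. \<forall>i. norm (z $ i) \<le> r} \<subseteq> U" using r by (auto simp: U_def intro: le_less_trans)
      fix v :: "complex^'n" assume v: "\<And>i. norm (v $ i) = r"
      obtain \<zeta> where \<zeta>: "\<And>i. norm (\<zeta> $ i) = 1" "v = r *\<^sub>R \<zeta>"
      proof (cases "r = 0")
        case True
        then have "v = 0" using v by (simp add: vec_eq_iff)
        then show ?thesis using that[of "\<chi> i. 1"] True by simp
      next
        case False
        then show ?thesis using that[of "(1 / r) *\<^sub>R v"] v r by simp
      qed
      have "exp (- C) \<le> norm (L a v)" unfolding \<zeta>(2) by (rule ray[OF \<zeta>(1) r(1,2)])
      then have "inverse (norm (L a v)) \<le> inverse (exp (- C))" by (rule le_imp_inverse_le) simp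
      then show "norm (inverse (L a v)) \<le> exp C" by (simp add: norm_inverse exp_minus)
    qed simp
    then have "inverse (exp C) \<le> inverse (norm (inverse (L a y)))"
      using LU[OF y] by (intro le_imp_inverse_le) simp_all
    then show ?thesis by (simp add: norm_inverse exp_minus)
  qed
  \<comment> \<open>Needed so that t \<open>z1\<close> lies in the open polydisc \<open>U\<close>
    for every t < 1.\<close>
  have bpos: "0 < b"
  proof (rule ccontr)
    assume "\<not> 0 < b"
    then have "z1 = 0" using z1 b by (simp add: vec_eq_iff)
    then show False using Lz1 L0 by simp
  qed
  have "z1 \<in> polydisc" using z1 b1 by (auto simp: polydisc_def intro: le_less_trans)
  then have "isCont (L a) z1"
    using has_derivative_continuous[OF mholD[OF mhol_L]] by blast
  \<comment> \<open>Approaching the zero \<open>z1\<close> radially from inside \<open>U\<close>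
    contradicts the uniform lower bound \<open>exp (- C)\<close>.\<close>
  then have "((\<lambda>t. L a (t *\<^sub>R z1)) \<longlongrightarrow> L a (1 *\<^sub>R z1)) (at_left 1)"
    by (intro isCont_tendsto_compose[of _ "L a"] tendsto_intros) simp
  then have "((\<lambda>t. norm (L a (t *\<^sub>R z1))) \<longlongrightarrow> 0) (at_left 1)"
    using Lz1 by (intro tendsto_norm_zero) simp
  moreover have "eventually (\<lambda>t::real. exp (- C) \<le> norm (L a (t *\<^sub>R z1))) (at_left 1)"
    using eventually_at_left_real[of 0 "1::real"]
  proof (rule eventually_mono)
    fix t :: real assume t: "t \<in> {0<..<1}"
    have "norm ((t *\<^sub>R z1) $ i) < b" for i
    proof -
      have "t * norm (z1 $ i) \<le> t * b" using t z1 by (intro mult_left_mono) auto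
      also have "\<dots> < b" using t bpos by simp
      finally show ?thesis using t by simp
    qed
    then show "exp (- C) \<le> norm (L a (t *\<^sub>R z1))" by (intro lower) (simp add: U_def)
  qed simp
  ultimately have "exp (- C) \<le> 0" by (rule tendsto_lowerbound) simp
  then show False by (simp add: not_le[symmetric])
qed

end

theorem corollary3p9:
  fixes \<alpha> :: real
  assumes "CARD('n::finite) \<ge> 2"
    and "\<alpha> \<ge> 0"
    and "real CARD('n) * sqrt (real CARD('n)) * \<alpha> \<le> 1 / 6.1"
  shows "\<forall>g \<in> (schwarz_family0 \<alpha> :: (complex^'n \<rightharpoonup> complex^'n) set). holomorphic_in g polydisc"
proof
  fix g :: "complex^'n \<rightharpoonup> complex^'n" assume "g \<in> schwarz_family0 \<alpha>"
  then obtain a f where g: "g = (projective_map a \<circ> f) |` polydisc" and f: "f \<in> schwarz_family \<alpha>"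
    and a: "of_nat (CARD('n) + 1) *s a = cgradient (cjacobian_det f) 0"
    unfolding schwarz_family0_def by blast
  interpret schwarz_bounded f \<alpha>
    by unfold_locales (use f assms in \<open>auto simp: schwarz_family_def\<close>)
  have f0: "f 0 = 0" and Df0: "cjacobian f 0 = mat 1" using f by (auto simp: schwarz_family_def)
  have zero: "(0 :: complex^'n) \<in> polydisc" by (simp add: polydisc_def)
  have L0: "L a 0 = 1" by (simp add: L_def f0)
  \<comment> \<open>This is what the choice of \<open>a\<close> achieves: at the origin the gradient
    of \<open>L\<close> is \<open>a\<close>, and \<open>p\<close> is minus the gradient of J divided
    by n + 1, that is, -\<open>a\<close>.\<close>
  have w0: "w a i 0 = 0" for i
  proof -
    have "cpartial i (L a) 0 = (\<Sum>l\<in>UNIV. a $ l * mat 1 $ l $ i)"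
      unfolding cpartial_L[OF zero] cjacobian_nth[symmetric] Df0 ..
    also have "\<dots> = a $ i" by (simp add: mat_def if_distrib cong: if_cong)
    finally have 1: "cpartial i (L a) 0 = a $ i" .
    have J: "J = cjacobian_det f" by (rule ext) (simp add: J_def)
    have J0: "J 0 = 1" by (simp add: J_def cjacobian_det_def Df0)
    have "(of_nat (CARD('n) + 1) *s a) $ i = cpartial i J 0"
      unfolding a J by (simp add: cgradient_def)
    then have "cpartial i J 0 = of_nat (CARD('n) + 1) * a $ i" by (simp only: vector_smult_component)
    then have "p i 0 = - (a $ i)" by (simp add: p_def J0 del: of_nat_add of_nat_Suc)
    then show ?thesis by (simp add: w_def L0 1)
  qed
  have nz: "L a z \<noteq> 0" if "z \<in> polydisc" for z
    using L_nonzero[OF numeric_condition[OF assms(3)] w0 L0 that] .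
  have gz: "g z = Some (inverse (L a z) *s f z)" if "z \<in> polydisc" for z
    using nz[OF that] that by (simp add: g projective_map_def L_def Let_def)
  have "mhol (\<lambda>z. the (g z) $ k) polydisc" for k
    by (rule mhol_cong[OF open_polydisc _ mhol_mult[OF mhol_inverse[OF mhol_L nz] mhol_component[of k]]])
       (simp_all add: gz)
  then show "holomorphic_in g polydisc"
    unfolding holomorphic_in_def using gz by (auto intro: cn_holomorphic_onI)
qed

end
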